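(* Let $\Lambda\subset \mathbb{S}^2$ be a continuum for which there are three different connected components $U_1,U_2,U_3$ of $\mathbb{S}^2\setminus\Lambda$ with $\partial U_1=\partial U_2=\partial U_3=\Lambda$. Let $f\colon \mathbb{S}^2\to\mathbb{S}^2$ be an area-preserving homeomorphism such that $f(\Lambda)=\Lambda$. Then there is an integer $n\geq 1$ such that $f^n|_{\Lambda}=\mathrm{Id}$, i.e. $f^n(x)=x$ for every $x\in\Lambda$.
   Context: A continuum is a nonempty compact connected set. The symbol $\partial$ denotes topological boundary in $\mathbb{S}^2$. Area-preserving means preserving the standard area measure on $\mathbb{S}^2$. The homeomorphism $f$ is not assumed to preserve orientation. *)

theory Defs
  imports "HOL-Analysis.Analysis"
begin

abbreviation S2 :: "(real^3) set" where
  "S2 \<equiv> sphere 0 1"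

definition continuum :: "'a::topological_space set \<Rightarrow> bool" where
  "continuum K \<longleftrightarrow> K \<noteq> {} \<and> compact K \<and> connected K"

text \<open>
  The standard area measure, on the Borel sets of the unit sphere, obtained from
  Lebesgue measure in polar coordinates: the area of \<open>A\<close> is three times the volume of
  the solid cone over \<open>A\<close> in the unit ball (see \<open>emeasure_sphere_area\<close>), the factor
  being the one coming from the integral of \<open>r^2\<close> over the unit interval.  The total
  area is \<open>4 * pi\<close> (see \<open>emeasure_sphere_area_S2\<close>).
\<close>

definition sphere_area :: "(real^3) measure" where
  "sphere_area = scale_measure 3
     (distr (restrict_space lborel (cball 0 1 - {0})) (restrict_space borel S2)
            (\<lambda>x. x /\<^sub>R norm x))"

definition area_preserving :: "(real^3 \<Rightarrow> real^3) \<Rightarrow> bool" where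
  "area_preserving f \<longleftrightarrow>
     f \<in> measurable sphere_area sphere_area \<and>
     (\<forall>A \<in> sets sphere_area.
        emeasure sphere_area (f -` A \<inter> S2) = emeasure sphere_area A)"

lemma space_sphere_area: "space sphere_area = S2"
  by (simp add: sphere_area_def space_scale_measure space_restrict_space)

lemma sets_sphere_area: "sets sphere_area = sets (restrict_space borel S2)"
  by (simp add: sphere_area_def)

lemma emeasure_sphere_area:
  assumes "A \<in> sets sphere_area"
  shows "emeasure sphere_area A =
           3 * emeasure lborel {x. x \<noteq> 0 \<and> norm x \<le> 1 \<and> x /\<^sub>R norm x \<in> A}"
proof -
  let ?P = "cball (0::real^3) 1 - {0}"
  have A: "A \<in> sets (restrict_space borel S2)"
    using assms by (simp add: sphere_area_def)
  have "(\<lambda>x::real^3. x /\<^sub>R norm x) \<in> measurable (restrict_space borel ?P) (restrict_space borel S2)"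
    by (intro measurable_restrict_space3) auto
  then have m: "(\<lambda>x::real^3. x /\<^sub>R norm x) \<in> measurable (restrict_space lborel ?P) (restrict_space borel S2)"
    by (subst measurable_cong_sets[where M' = "restrict_space borel ?P" and N' = "restrict_space borel S2"])
       (auto simp: sets_restrict_space)
  have eq: "(\<lambda>x. x /\<^sub>R norm x) -` A \<inter> ?P = {x. x \<noteq> 0 \<and> norm x \<le> 1 \<and> x /\<^sub>R norm x \<in> A}"
    by auto
  show ?thesis
    using A m
    by (simp add: sphere_area_def emeasure_distr emeasure_restrict_space space_restrict_space
        del: Diff_iff flip: eq)
qed

lemma emeasure_sphere_area_S2: "emeasure sphere_area S2 = ennreal (4 * pi)"
proof -
  have "S2 \<in> sets sphere_area"
    using sets.top[of sphere_area] by (simp add: space_sphere_area)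
  then have "emeasure sphere_area S2 =
      3 * emeasure lborel {x::real^3. x \<noteq> 0 \<and> norm x \<le> 1 \<and> x /\<^sub>R norm x \<in> S2}"
    by (rule emeasure_sphere_area)
  also have "{x::real^3. x \<noteq> 0 \<and> norm x \<le> 1 \<and> x /\<^sub>R norm x \<in> S2} = cball 0 1 - {0}"
    by auto
  also have "emeasure lborel (cball (0::real^3) 1 - {0}) = emeasure lborel (cball (0::real^3) 1)"
    by (intro emeasure_Diff_null_set) auto
  also have "\<dots> = ennreal (4 / 3 * pi)"
    using emeasure_cball[of 1 "0::real^3"] by (simp add: eval_unit_ball_vol)
  also have "3 * ennreal (4 / 3 * pi) = ennreal (4 * pi)"
    using ennreal_mult[of 3 "4 / 3 * pi"] by simp
  finally show ?thesis .
qed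

end

(*
  Replace f by an iterate F that leaves each U_i invariant; we show F^2 = id on \<Lambda>.  Otherwise some x in
  \<Lambda> has three distinct points x, F x, F^2 x, and x is the centre of a small closed disc B such that
  B, F B, F^2 B are pairwise disjoint.

  Fix an invariant component U.  A component c of the intersection of U with the boundary circle of one
  of the three discs is a crosscut: as the complement of U is connected, Janiszewski's theorem shows that
  c cuts U into two sides.  Since c and F c are disjoint and F preserves area, the two sides of c cannot
  both have at most half the area of U, so exactly one side D(c) is small.  Choose c on the boundary of B
  with D(c) of maximal area.  A crosscut separating two of c, F c, F^2 c would have a strictly larger small
  side; hence c, F c, F^2 c are all adjacent to one component W of U minus the three circles, and W lies
  outside the discs.

  Doing this for three components U_i yields three disjoint regions W_i, each joined to the three disjoint
  discs, i.e. a planar drawing of the graph K_{3,3}.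
*)
theory Submission
  imports Defs
begin

section \<open>Planar topology\<close>

text \<open>Equality of the boundaries puts the chosen point of \<Lambda> into the closure of every
  \<open>U_i\<close>, so each \<open>U_i\<close> enters the disc; being invariant, it cannot stay
  inside, since the disc and its image are disjoint. Hence the boundary circle cuts every
  \<open>U_i\<close>. The obstacle is that a circle may cut \<open>U_i\<close> in infinitely many
  crosscuts, with no preferred inside. Area supplies what is missing: it singles out a side of each
  crosscut, ranks the crosscuts, and leaves only finitely many that cut off more than a given
  positive amount, so that a largest one exists. Being preserved, it has the same maximum on all
  three circles. Finiteness of the total area also yields the iterate: a component has positive
  area, and its images are equal or disjoint. The exponent 2 comes from the graph: both vertex
  classes need three members, hence three distinct points of an orbit, and points of period at most
  2 escape the argument.\<close>

text \<open>A component whose closure missed \<open>A\<close> would be closed in \<open>U\<close>,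
  and by local connectedness it is open in \<open>U\<close>; this contradicts the connectedness of
  \<open>U\<close>.\<close>

lemma component_diff_adheres:
  fixes U :: "'a::topological_space set"
  assumes "locally connected U" "connected U" "closedin (top_of_set U) A" "A \<noteq> {}"
    and C: "C \<in> components (U - A)"
  shows "closure C \<inter> A \<noteq> {}"
proof
  assume disj: "closure C \<inter> A = {}"
  have "openin (top_of_set U) (U - A)"
    using assms(3) by (simp add: openin_diff)
  then have o: "openin (top_of_set U) C"
    using C assms(1) locally_connected_open_component by blast
  have "closedin (top_of_set (U - A)) C"
    using C closedin_component by blast
  then obtain T where T: "closed T" "C = (U - A) \<inter> T"
    by (metis closedin_closed)
  have "closure C \<subseteq> T"
    using T by (simp add: closure_minimal)
  then have "C = U \<inter> closure C"
    using T disj closure_subset[of C] by blast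
  then have "closedin (top_of_set U) C"
    by (metis closedin_closed closed_closure)
  then have "C = {} \<or> C = U"
    using o assms(2) connected_clopen by blast
  then show False
    using C assms(3,4) in_components_nonempty in_components_subset closedin_imp_subset
    by (metis Diff_disjoint Int_absorb1 Int_commute order_trans subset_empty)
qed

text \<open>
  The nonplanarity of \<open>K\<^sub>3\<^sub>,\<^sub>3\<close>, with \<open>a\<close>, \<open>b\<close>, \<open>c\<close> on one side.  Take the component \<open>V\<close> of the
  complement of the closed curve \<open>g1 \<union> g2\<close> that misses \<open>Y3\<close>.  Points of \<open>V\<close> near the interiors of \<open>g1\<close> and
  \<open>g2\<close> show that neither \<open>g2 \<union> g3\<close> nor \<open>g1 \<union> g3\<close> separates \<open>V\<close> from \<open>c\<close>, so by Janiszewski's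
  theorem their union does not either.
\<close>

lemma theta_no_centre:
  fixes a b c :: complex
  assumes arcs: "arc g1" "arc g2" "arc g3"
    and ends: "pathstart g1 = a" "pathstart g2 = a" "pathstart g3 = a"
      "pathfinish g1 = b" "pathfinish g2 = b" "pathfinish g3 = b"
    and meet: "path_image g1 \<inter> path_image g2 = {a, b}"
      "path_image g1 \<inter> path_image g3 = {a, b}" "path_image g2 \<inter> path_image g3 = {a, b}"
    and Y: "connected Y1" "connected Y2" "connected Y3" "c \<in> Y1" "c \<in> Y2" "c \<in> Y3"
    and sub: "path_image g1 - {a, b} \<subseteq> Y1" "path_image g2 - {a, b} \<subseteq> Y2"
      "path_image g3 - {a, b} \<subseteq> Y3"
    and disj: "Y1 \<inter> (path_image g2 \<union> path_image g3) = {}"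
      "Y2 \<inter> (path_image g1 \<union> path_image g3) = {}"
      "Y3 \<inter> (path_image g1 \<union> path_image g2) = {}"
  shows False
proof -
  let ?A1 = "path_image g1" and ?A2 = "path_image g2" and ?A3 = "path_image g3"
  let ?g = "g1 +++ reversepath g2"
  have ab: "a \<in> ?A1" "b \<in> ?A1" "a \<in> ?A2" "b \<in> ?A2" "a \<in> ?A3" "b \<in> ?A3"
    using ends by (metis pathstart_in_path_image pathfinish_in_path_image)+
  have "a \<noteq> b"
    using arcs(1) ends arc_distinct_ends by blast
  have loop: "simple_path ?g" "pathfinish ?g = pathstart ?g"
    using arcs ends meet(1) by (simp_all add: simple_path_join_loop arc_reversepath)
  have img: "path_image ?g = ?A1 \<union> ?A2"
    using ends by (simp add: path_image_join)
  obtain I E where IE: "open I" "connected I" "open E" "connected E" "I \<inter> E = {}"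
    "I \<union> E = - (?A1 \<union> ?A2)" "frontier I = ?A1 \<union> ?A2" "frontier E = ?A1 \<union> ?A2"
    using Jordan_curve[OF loop] img by metis
  have "Y3 \<subseteq> I \<or> Y3 \<subseteq> E"
  proof -
    have "Y3 \<subseteq> I \<union> E" using IE(6) disj(3) by blast
    then show ?thesis
      using connectedD[OF Y(3) IE(1,3)] IE(5) by blast
  qed
  \<comment> \<open>Both components given by the Jordan curve theorem are treated alike.
    \<open>Vc\<close> records the maximality of \<open>V\<close> among connected sets off the curve;
    it yields the contradiction at the end.\<close>
  then obtain V where O: "open V" "connected V" "V \<inter> (?A1 \<union> ?A2) = {}" "frontier V = ?A1 \<union> ?A2"
      "V \<inter> Y3 = {}" and Vc: "\<And>T. connected T \<Longrightarrow> T \<inter> (?A1 \<union> ?A2) = {} \<Longrightarrow> T \<inter> V \<noteq> {} \<Longrightarrow> T \<subseteq> V"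
  proof
    assume *: "Y3 \<subseteq> I"
    show thesis
    proof (rule that[of E])
      fix T assume T: "connected T" "T \<inter> (?A1 \<union> ?A2) = {}" "T \<inter> E \<noteq> {}"
      then have "T \<subseteq> I \<union> E" using IE by blast
      then show "T \<subseteq> E" using connectedD[OF T(1) IE(1,3)] IE(5) T(3) by blast
    qed (use IE * in auto)
  next
    assume *: "Y3 \<subseteq> E"
    show thesis
    proof (rule that[of I])
      fix T assume T: "connected T" "T \<inter> (?A1 \<union> ?A2) = {}" "T \<inter> I \<noteq> {}"
      then have "T \<subseteq> I \<union> E" using IE by blast
      then show "T \<subseteq> I" using connectedD[OF T(1) IE(1,3)] IE(5) T(3) by blast
    qed (use IE * in auto)
  qed
  have V3: "V \<inter> ?A3 = {}"
    using O(3,5) sub(3) ab by blast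
  have cl: "closed ?A1" "closed ?A2" "closed ?A3"
    using arcs by (simp_all add: closed_arc_image)
  have inner: "\<exists>y. y \<in> path_image g - {a, b}" if "arc g" for g
  proof -
    have "infinite (path_image g)"
      using connected_finite_iff_sing[OF connected_arc_image[OF that]] that
      by (metis arc_distinct_ends pathfinish_in_path_image pathstart_in_path_image
          empty_iff singletonD)
    then show ?thesis
      by (metis Diff_eq_empty_iff ex_in_conv finite.emptyI finite_insert finite_subset)
  qed
  \<comment> \<open>A point \<open>y\<close> of the curve lies on the frontier of \<open>V\<close>,
    so a small ball around it contains a point of \<open>V\<close>; the ball together with
    \<open>Y\<close> joins that point to \<open>c\<close> off \<open>T\<close>.\<close>
  have reach: "\<exists>p\<in>V. connected_component (- T) p c"
    if T: "closed T" and y: "y \<in> ?A1 \<union> ?A2" "y \<in> Y" "connected Y" "c \<in> Y" "Y \<inter> T = {}" for T y Y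
  proof -
    have "y \<notin> T" using y by blast
    then obtain e where e: "e > 0" "ball y e \<subseteq> - T"
      using T by (metis ComplI open_Compl open_contains_ball)
    have "y \<in> closure V"
      using y(1) O(4) unfolding frontier_def by blast
        then obtain p where p: "p \<in> V" "dist p y < e"
      using e(1) closure_approachable by blast
    have "connected (ball y e \<union> Y)"
    proof (rule connected_Un)
      show "ball y e \<inter> Y \<noteq> {}"
        using y(2) centre_in_ball[of y e] e(1) by blast
    qed (use y in auto)
    moreover have "ball y e \<union> Y \<subseteq> - T" using e y by blast
    ultimately have "connected_component (- T) p c"
      using p y unfolding connected_component_def
      by (metis UnCI dist_commute mem_ball)
    then show ?thesis using p by blast
  qed
  obtain y1 y2 where y12: "y1 \<in> ?A1 - {a, b}" "y2 \<in> ?A2 - {a, b}"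
    using inner arcs by meson
  have "\<exists>p\<in>V. connected_component (- (?A2 \<union> ?A3)) p c"
    by (rule reach[of _ y1 Y1]) (use y12 sub disj Y cl in auto)
  then obtain p where p: "p \<in> V" "connected_component (- (?A2 \<union> ?A3)) p c" by blast
  have "\<exists>p\<in>V. connected_component (- (?A1 \<union> ?A3)) p c"
    by (rule reach[of _ y2 Y2]) (use y12 sub disj Y cl in auto)
  then obtain q where q: "q \<in> V" "connected_component (- (?A1 \<union> ?A3)) q c" by blast
  have "connected_component (- (?A1 \<union> ?A3)) p q"
    using O(2,3) V3 p(1) q(1) unfolding connected_component_def by blast
  then have pc: "connected_component (- (?A1 \<union> ?A3)) p c"
    using q(2) connected_component_trans by blast
  have "connected_component (- ((?A1 \<union> ?A3) \<union> (?A2 \<union> ?A3))) p c"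
  proof (rule Janiszewski[OF _ _ _ pc p(2)])
    show "compact (?A1 \<union> ?A3)"
      using arcs by (simp add: compact_Un compact_arc_image)
    show "closed (?A2 \<union> ?A3)" using cl by blast
    \<comment> \<open>The common points \<open>a\<close> and \<open>b\<close> of the first two arcs
      already lie on the third, so the intersection is a single arc, connected as Janiszewski's
      theorem demands.\<close>
    have "(?A1 \<union> ?A3) \<inter> (?A2 \<union> ?A3) = ?A3"
      using meet ab by blast
    then show "connected ((?A1 \<union> ?A3) \<inter> (?A2 \<union> ?A3))"
      using arcs(3) connected_arc_image by metis
  qed
  then obtain T where T: "connected T" "T \<subseteq> - ((?A1 \<union> ?A3) \<union> (?A2 \<union> ?A3))" "p \<in> T" "c \<in> T"
    unfolding connected_component_def by blast
  have "T \<subseteq> V"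
    by (rule Vc) (use T p in auto)
  then show False using T(4) O(5) Y(6) by blast
qed

text \<open>Every component of \<open>C - {p}\<close> accumulates at \<open>p\<close> and therefore
  meets the connected set \<open>N - {p}\<close>; so there is only one.\<close>

lemma connected_diff_point:
  fixes C :: "'a::t1_space set"
  assumes "locally connected C" "connected C" "p \<in> C"
    and N: "openin (top_of_set C) N" "p \<in> N" "connected (N - {p})" 
  shows "connected (C - {p})"
proof -
  have cl: "closedin (top_of_set C) {p}"
    using assms(3) by (simp add: closed_subset)
  have "D = E" if "D \<in> components (C - {p})" "E \<in> components (C - {p})" for D E
  proof -
    have meets: "N - {p} \<subseteq> D" if D: "D \<in> components (C - {p})" for D
    proof -
      obtain T where T: "open T" "N = C \<inter> T"
        using N(1) by (metis openin_open)
      have "p \<in> closure D"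
        using component_diff_adheres[OF assms(1,2) cl _ D] by simp
      then have "D \<inter> T \<noteq> {}"
        using T N(2) open_Int_closure_eq_empty[of T D] by blast
      moreover have "D \<subseteq> C - {p}" using D in_components_subset by blast
      ultimately have "D \<inter> (N - {p}) \<noteq> {}" using T by blast
      moreover have "N - {p} \<subseteq> C - {p}" using T by blast
      ultimately show ?thesis
        using components_maximal[OF D N(3)] by blast
    qed
    have "N - {p} \<noteq> {}"
    proof
      assume "N - {p} = {}"
      then have "N = {p}" using N(2) by blast
      then have "openin (top_of_set C) {p}" using N(1) by simp
      then have "C = {p}"
        using cl assms(2) connected_clopen by blast
      then show False
        using that by simp
    qed
    then show ?thesis
      using meets[OF that(1)] meets[OF that(2)] components_nonoverlap[OF that] by blast
  qed
  note unique = this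
  show ?thesis
    unfolding connected_iff_connected_component
  proof (intro ballI)
    fix x y assume "x \<in> C - {p}" "y \<in> C - {p}"
    then have "connected_component_set (C - {p}) x = connected_component_set (C - {p}) y"
      by (intro unique componentsI)
    then show "connected_component (C - {p}) x y"
      using \<open>y \<in> C - {p}\<close> by (metis connected_component_refl mem_Collect_eq)
  qed
qed

section \<open>Charts of the sphere and crosscuts\<close>

text \<open>Near a logarithm of \<open>z\<close> the exponential map turns the imaginary axis into
  the unit circle. \<open>N\<close> is the image of a ball, and its parts on, outside and inside the
  circle are images of convex pieces of that ball. The outer half ball together with its centre is
  starlike, which makes \<open>z\<close> accessible by paths from outside.\<close>

lemma circle_flat_neighbourhood:
  fixes z :: complex
  assumes "norm z = 1" "open V" "z \<in> V"
  obtains N where "open N" "z \<in> N" "N \<subseteq> V" "connected N"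
    "connected (N \<inter> sphere 0 1)" "connected (N - cball 0 1)" "connected (N \<inter> ball 0 1)"
    "N \<inter> sphere 0 1 \<subseteq> closure (N - cball 0 1)" "N \<inter> sphere 0 1 \<subseteq> closure (N \<inter> ball 0 1)"
    "path_connected (insert z (N - cball 0 1))"
proof -
  define w where "w = Ln z"
  have "z \<noteq> 0" using assms(1) by auto
  then have ew: "exp w = z" and rw: "Re w = 0"
    using assms(1) by (simp_all add: w_def)
  have "open (exp -` V :: complex set)"
    using assms(2) by (intro open_vimage continuous_intros)
  then obtain d where d: "d > 0" "ball w d \<subseteq> exp -` V"
    using ew assms(3) by (metis open_contains_ball vimage_eq)
  \<comment> \<open>The bound \<open>pi\<close> keeps \<open>exp\<close> injective on the ball, so
    that its image is open by invariance of domain.\<close>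
  define e where "e = min d pi"
  define B where "B = ball w e"
  have e: "e > 0" and BV: "B \<subseteq> exp -` V" and Bpi: "B \<subseteq> ball w pi"
    using d by (auto simp: e_def B_def)
  have wB: "w \<in> B" and oB: "open B" and cB: "convex B"
    using e by (auto simp: B_def)
  define N where "N = exp ` B"
  have cont: "continuous_on T exp" for T :: "complex set"
    by (intro continuous_intros)
  have sph: "N \<inter> sphere 0 1 = exp ` (B \<inter> {x. Re x = 0})"
    by (auto simp: N_def)
  have out: "N - cball 0 1 = exp ` (B \<inter> {x. Re x > 0})"
    by (auto simp: N_def)
  have inn: "N \<inter> ball 0 1 = exp ` (B \<inter> {x. Re x < 0})"
    by (auto simp: N_def)
  have con: "convex (B \<inter> {x. Re x = 0})" "convex (B \<inter> {x. Re x > 0})" "convex (B \<inter> {x. Re x < 0})"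
  proof -
    show "convex (B \<inter> {x. Re x = 0})"
      using cB by (intro convex_Int) (auto simp: convex_alt)
    show "convex (B \<inter> {x. Re x > 0})" "convex (B \<inter> {x. Re x < 0})"
      by (intro convex_Int cB convex_halfspace_Re_gt convex_halfspace_Re_lt)+
  qed
  have clH: "x \<in> closure (B \<inter> {x. Re x > 0})" "x \<in> closure (B \<inter> {x. Re x < 0})"
    if "x \<in> B" "Re x = 0" for x
  proof -
    have "x \<in> closure {x. Re x > 0}"
      unfolding closure_approachable
    proof (intro allI impI)
      fix r :: real assume "r > 0"
      then show "\<exists>y\<in>{x. 0 < Re x}. dist y x < r"
        using that by (intro bexI[of _ "x + of_real (r/2)"]) (auto simp: dist_norm)
    qed
    moreover have "x \<in> closure {x. Re x < 0}"
      unfolding closure_approachable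
    proof (intro allI impI)
      fix r :: real assume "r > 0"
      then show "\<exists>y\<in>{x. Re x < 0}. dist y x < r"
        using that by (intro bexI[of _ "x - of_real (r/2)"]) (auto simp: dist_norm)
    qed
    ultimately show "x \<in> closure (B \<inter> {x. Re x > 0})" "x \<in> closure (B \<inter> {x. Re x < 0})"
      using open_Int_closure_subset[OF oB] that(1) by blast+
  qed
  have expcl: "exp ` closure A \<subseteq> closure (exp ` A)" for A :: "complex set"
    by (rule image_closure_subset[OF cont closed_closure closure_subset])
  show thesis
  proof (rule that[of N])
    show "open N"
      unfolding N_def
      by (rule invariance_of_domain[OF cont oB inj_on_subset[OF inj_on_exp_pi Bpi]])
    show "z \<in> N" using wB ew by (auto simp: N_def)
    show "N \<subseteq> V" using BV by (auto simp: N_def)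
    show "connected N"
      unfolding N_def by (intro connected_continuous_image cont convex_connected cB)
    show "connected (N \<inter> sphere 0 1)" "connected (N - cball 0 1)" "connected (N \<inter> ball 0 1)"
      unfolding sph out inn by (intro connected_continuous_image cont convex_connected con)+
    show "N \<inter> sphere 0 1 \<subseteq> closure (N - cball 0 1)" "N \<inter> sphere 0 1 \<subseteq> closure (N \<inter> ball 0 1)"
      using clH expcl unfolding sph out inn by blast+
    have "insert z (N - cball 0 1) = exp ` (insert w (B \<inter> {x. Re x > 0}))"
      using ew unfolding out by simp
    moreover have "starlike (insert w (B \<inter> {x. Re x > 0}))"
      unfolding starlike_def
    proof (intro bexI[of _ w] ballI subsetI)
      fix x y assume x: "x \<in> insert w (B \<inter> {x. Re x > 0})" and y: "y \<in> closed_segment w x"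
      have xB: "x \<in> B" using x wB by blast
      obtain u where u: "0 \<le> u" "u \<le> 1" "y = (1 - u) *\<^sub>R w + u *\<^sub>R x"
        using y by (auto simp: in_segment)
      have "y \<in> B"
        using cB wB xB y closed_segment_subset by blast
      moreover have "Re y = u * Re x" using u rw by simp
      ultimately show "y \<in> insert w (B \<inter> {x. Re x > 0})"
        using x u rw by (cases "u = 0") auto
    qed auto
    ultimately show "path_connected (insert z (N - cball 0 1))"
      by (metis cont path_connected_continuous_image starlike_imp_path_connected)
  qed
qed

section \<open>Charts of the sphere defined on the whole plane\<close>

abbreviation sopen :: "(real^3) set \<Rightarrow> bool" where
  "sopen \<equiv> openin (top_of_set S2)"

text \<open>The discs of the proof are the images of the closed unit disc. Defining charts on the
  entire plane puts the boundary circle in the interior of the domain, and composition with a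
  homeomorphism of the sphere gives a chart again.\<close>

definition sphere_chart :: "(complex \<Rightarrow> real^3) \<Rightarrow> bool" where
  "sphere_chart h \<longleftrightarrow> (\<exists>q k. q \<in> S2 \<and> homeomorphism UNIV (S2 - {q}) h k)"

lemma antipode_neq:
  fixes x :: "real^3"
  assumes "x \<in> S2"
  shows "x \<noteq> - x"
proof
  assume "x = - x"
  then have "2 *\<^sub>R x = 0" by (metis scaleR_2 add.right_inverse)
  then show False using assms by simp
qed

lemma ex_sphere_chart:
  assumes "q \<in> S2"
  obtains h k where "homeomorphism (UNIV::complex set) (S2 - {q}) h k"
proof -
  have "(S2 - {q}) homeomorphic (UNIV::complex set)"
    using assms by (intro homeomorphic_punctured_sphere_affine) (auto simp: aff_dim_UNIV)
  then show ?thesis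
    using that homeomorphic_sym unfolding homeomorphic_def by blast
qed

lemma sphere_chart_inj: "sphere_chart h \<Longrightarrow> inj h"
  unfolding sphere_chart_def homeomorphism_def by (metis UNIV_I injI)

lemma sphere_chart_continuous: "sphere_chart h \<Longrightarrow> continuous_on T h"
  unfolding sphere_chart_def homeomorphism_def by (meson continuous_on_subset top_greatest)

lemma sphere_chart_subset: "sphere_chart h \<Longrightarrow> h ` T \<subseteq> S2"
  unfolding sphere_chart_def homeomorphism_def by blast

lemma sphere_chart_open:
  assumes "sphere_chart h" "open V"
  shows "sopen (h ` V)"
proof -
  obtain q k where q: "q \<in> S2" "homeomorphism UNIV (S2 - {q}) h k"
    using assms sphere_chart_def by blast
  have "openin (top_of_set (S2 - {q})) (h ` V)"
    using homeomorphism_imp_open_map[OF q(2)] assms(2) by simp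
  moreover have "sopen (S2 - {q})"
    by (simp add: openin_delete)
  ultimately show ?thesis
    using openin_trans by blast
qed

lemma sphere_chart_compose:
  assumes "sphere_chart h" "homeomorphism S2 S2 f g"
  shows "sphere_chart (f \<circ> h)"
proof -
  obtain q k where q: "q \<in> S2" "homeomorphism UNIV (S2 - {q}) h k"
    using assms sphere_chart_def by blast
  have "f ` (S2 - {q}) = S2 - {f q}"
  proof -
    have "inj_on f S2" using assms(2) by (metis homeomorphism_def inj_on_inverseI)
    moreover have "f ` S2 = S2" using assms(2) homeomorphism_image1 by blast
    ultimately show ?thesis
      using inj_on_image_set_diff[of f S2 S2 "{q}"] q(1) by simp
  qed
  then have "homeomorphism (S2 - {q}) (S2 - {f q}) f g"
    by (intro homeomorphism_of_subsets[OF assms(2), where T'' = "S2 - {f q}"]) auto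
  then have "homeomorphism UNIV (S2 - {f q}) (f \<circ> h) (k \<circ> g)"
    using q(2) homeomorphism_compose by blast
  moreover have "f q \<in> S2"
    using assms(2) q(1) unfolding homeomorphism_def by blast
  ultimately show ?thesis
    unfolding sphere_chart_def by blast
qed

lemma sphere_chart_vimage_open:
  assumes "sphere_chart h" "sopen U"
  shows "open (h -` U)"
proof -
  obtain T where "open T" "U = S2 \<inter> T"
    using assms(2) openin_open by blast
  moreover have "h -` U = h -` T" 
    using sphere_chart_subset[OF assms(1), of UNIV] \<open>U = S2 \<inter> T\<close> by blast
  ultimately show ?thesis
    using open_vimage[OF \<open>open T\<close> sphere_chart_continuous[OF assms(1)]] by simp
qed

lemma sphere_chart_image_closure:
  "sphere_chart h \<Longrightarrow> h ` closure T \<subseteq> closure (h ` T)"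
  by (rule image_closure_subset[OF sphere_chart_continuous closed_closure closure_subset])

lemma chart_circle_flat_neighbourhood:
  assumes h: "sphere_chart h" and U: "sopen U" and z: "z \<in> U" "z \<in> h ` sphere 0 1"
  obtains N where "sopen N" "z \<in> N" "N \<subseteq> U" "connected N"
    "connected (N \<inter> h ` sphere 0 1)" "connected (N - h ` cball 0 1)" "connected (N \<inter> h ` ball 0 1)"
    "N \<inter> h ` sphere 0 1 \<subseteq> closure (N - h ` cball 0 1)"
    "N \<inter> h ` sphere 0 1 \<subseteq> closure (N \<inter> h ` ball 0 1)"
    "path_connected (insert z (N - h ` cball 0 1))"
proof -
  obtain u where u: "norm u = 1" "z = h u" using z by auto
  have inj: "inj h" using h by (rule sphere_chart_inj)
  obtain N where N: "open N" "u \<in> N" "N \<subseteq> h -` U" "connected N"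
    "connected (N \<inter> sphere 0 1)" "connected (N - cball 0 1)" "connected (N \<inter> ball 0 1)"
    "N \<inter> sphere 0 1 \<subseteq> closure (N - cball 0 1)" "N \<inter> sphere 0 1 \<subseteq> closure (N \<inter> ball 0 1)"
    "path_connected (insert u (N - cball 0 1))"
    using circle_flat_neighbourhood[of u "h -` U"] sphere_chart_vimage_open[OF h U] u z(1) by blast
  note cont = sphere_chart_continuous[OF h]
  have im: "h ` N \<inter> h ` sphere 0 1 = h ` (N \<inter> sphere 0 1)" "h ` N - h ` cball 0 1 = h ` (N - cball 0 1)"
    "h ` N \<inter> h ` ball 0 1 = h ` (N \<inter> ball 0 1)"
    using inj by (auto simp: image_Int image_set_diff)
  show thesis
  proof (rule that[of "h ` N"])
    show "sopen (h ` N)" using sphere_chart_open[OF h N(1)] .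
    show "z \<in> h ` N" "h ` N \<subseteq> U" using u N by auto
    show "connected (h ` N)" using N(4) cont connected_continuous_image by blast
    show "connected (h ` N \<inter> h ` sphere 0 1)" "connected (h ` N - h ` cball 0 1)"
      "connected (h ` N \<inter> h ` ball 0 1)"
      unfolding im using N cont connected_continuous_image by blast+
    show "h ` N \<inter> h ` sphere 0 1 \<subseteq> closure (h ` N - h ` cball 0 1)"
      "h ` N \<inter> h ` sphere 0 1 \<subseteq> closure (h ` N \<inter> h ` ball 0 1)"
      unfolding im using N(8,9) sphere_chart_image_closure[OF h] by blast+
    have "insert z (h ` (N - cball 0 1)) = h ` insert u (N - cball 0 1)"
      using u by simp
    then show "path_connected (insert z (h ` N - h ` cball 0 1))"
      unfolding im using N(10) cont path_connected_continuous_image by metis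
  qed
qed

section \<open>Open subsets of the sphere and Janiszewski's theorem\<close>

lemma sopen_imp_locally_connected: "sopen U \<Longrightarrow> locally connected U"
  using locally_connected_sphere locally_open_subset by blast

lemma sopen_component: "sopen U \<Longrightarrow> C \<in> components U \<Longrightarrow> sopen C"
  using locally_connected_sphere locally_connected_open_component by blast

text \<open>A chart omitting the antipode of \<open>p\<close> carries a punctured planar disc, which
  is connected, to a punctured neighbourhood of \<open>p\<close>. The fact allows the passage from
  the sphere to the plane, where one point is lost.\<close>

lemma sopen_connected_delete:
  assumes U: "sopen U" "connected U" 
  shows "connected (U - {p})"
proof (cases "p \<in> U")
  case True
  have p: "p \<in> S2" using True U(1) openin_imp_subset by blast
  then have "- p \<in> S2" "p \<noteq> - p" using antipode_neq by auto
  then obtain h k where hk: "homeomorphism (UNIV::complex set) (S2 - {- p}) h k"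
    using ex_sphere_chart by blast
  then have h: "sphere_chart h"
    unfolding sphere_chart_def using \<open>- p \<in> S2\<close> by blast
  obtain u where u: "p = h u"
    using hk p \<open>p \<noteq> - p\<close> unfolding homeomorphism_def by blast
  obtain e where e: "e > 0" "ball u e \<subseteq> h -` U"
    using sphere_chart_vimage_open[OF h U(1)] True u by (metis open_contains_ball vimage_eq)
  show ?thesis
  proof (rule connected_diff_point[OF sopen_imp_locally_connected[OF U(1)] U(2) True])
    show "openin (top_of_set U) (h ` ball u e)"
      using sphere_chart_open[OF h open_ball] e U(1) 
      by (meson image_subset_iff_subset_vimage openin_imp_subset openin_subset_trans)
    show "p \<in> h ` ball u e" using u e by auto
    have "h ` ball u e - {p} = h ` (ball u e - {u})"
      using sphere_chart_inj[OF h] u by (auto simp: inj_def)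
    then show "connected (h ` ball u e - {p})"
      using connected_punctured_ball[of u e] sphere_chart_continuous[OF h]
        connected_continuous_image by (metis DIM_complex order_refl)
  qed
qed (use U in auto)

lemma sopen_infinite:
  assumes "sopen U" "U \<noteq> {}"
  shows "infinite U"
proof -
  obtain x where x: "x \<in> U" using assms by blast
  have "x \<in> S2" using x assms(1) openin_imp_subset by blast
  then have "- x \<in> S2" "x \<noteq> - x" using antipode_neq by auto
  then obtain h k where hk: "homeomorphism (UNIV::complex set) (S2 - {- x}) h k"
    using ex_sphere_chart by blast
  then have h: "sphere_chart h"
    unfolding sphere_chart_def using \<open>- x \<in> S2\<close> by blast
  have "h -` U \<noteq> {}"
    using hk x \<open>x \<in> S2\<close> \<open>x \<noteq> - x\<close> unfolding homeomorphism_def by blast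
  then have "infinite (h -` U)"
    using sphere_chart_vimage_open[OF h assms(1)] finite_imp_not_open by blast
  then show ?thesis
    using finite_vimageI[OF _ sphere_chart_inj[OF h]] by blast
qed

text \<open>Deleting a point \<open>p\<close> off \<open>S \<union> T\<close>, distinct from
  \<open>a\<close> and \<open>b\<close>, moves the problem to the plane. A set joining
  \<open>a\<close> to \<open>b\<close> may run through \<open>p\<close>, but the whole component is
  open and stays connected without \<open>p\<close>.\<close>

theorem Janiszewski_sphere:
  assumes ST: "compact S" "compact T" "S \<subseteq> S2" "T \<subseteq> S2" "connected (S \<inter> T)"
    and a: "connected_component (S2 - S) a b" "connected_component (S2 - T) a b"
  shows "connected_component (S2 - (S \<union> T)) a b"
proof -
  have o: "sopen (S2 - S)" "sopen (S2 - T)" "sopen (S2 - (S \<union> T))"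
    using ST by (auto intro!: openin_diff closed_subset compact_imp_closed compact_Un)
  have ab: "a \<in> S2 - (S \<union> T)" "b \<in> S2 - (S \<union> T)"
    using a connected_component_in by (metis Diff_iff Un_iff)+
  then have "infinite (S2 - (S \<union> T))" using sopen_infinite o by blast
  then obtain p where p: "p \<in> S2 - (S \<union> T)" "p \<noteq> a" "p \<noteq> b"
    by (metis (no_types, lifting) finite.emptyI finite_insert finite_subset insertCI subsetI)
  then have "p \<in> S2" by blast
  then obtain h k where hk: "homeomorphism (UNIV::complex set) (S2 - {p}) h k"
    using ex_sphere_chart by blast
  have hkid: "\<And>x. x \<in> S2 - {p} \<Longrightarrow> h (k x) = x" "\<And>z. k (h z) = z"
    "\<And>z. h z \<in> S2 - {p}" "continuous_on (S2 - {p}) k" "continuous_on UNIV h"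
    using homeomorphism_apply1[OF hk] homeomorphism_apply2[OF hk] homeomorphism_image1[OF hk]
      homeomorphism_cont1[OF hk] homeomorphism_cont2[OF hk] rangeI[of h] by simp_all
  have pl: "connected_component (- (k ` R)) (k a) (k b)"
    if "connected_component (S2 - R) a b" "R \<subseteq> S2 - {p}" "sopen (S2 - R)" for R
  proof -
    define C where "C = connected_component_set (S2 - R) a"
    have C: "connected C" "C \<subseteq> S2 - R" "a \<in> C" "b \<in> C"
      using that(1) connected_component_subset[of "S2 - R" a] connected_component_in[OF that(1)]
        connected_component_refl[of a "S2 - R"] unfolding C_def by blast+
    have "sopen C"
      using that(3) C_def C(3) sopen_component by (metis C(2) componentsI subsetD)
    then have "connected (C - {p})" using C(1) sopen_connected_delete by blast
    then have "connected (k ` (C - {p}))"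
      using C(2) hkid(4) by (intro connected_continuous_image) (auto intro: continuous_on_subset)
    moreover have "k ` (C - {p}) \<subseteq> - k ` R"
    proof (intro image_subsetI ComplI)
      fix y assume y: "y \<in> C - {p}" and "k y \<in> k ` R"
      then obtain r where r: "r \<in> R" "k y = k r" by blast
      have "y \<in> S2 - {p}" "r \<in> S2 - {p}" using y C(2) that(2) r(1) by blast+
      then have "y = r"
        using hkid(1) r(2) by metis
      then show False using y C(2) r(1) by blast
    qed
    ultimately show ?thesis
      using C p unfolding connected_component_def by blast
  qed
  have sub: "S \<subseteq> S2 - {p}" "T \<subseteq> S2 - {p}" using ST p by auto
  have comp: "compact (k ` S)" "compact (k ` T)"
    using ST sub hkid(4) by (auto intro!: compact_continuous_image intro: continuous_on_subset)
  have "inj_on k (S2 - {p})" using hkid(1) by (metis inj_onI)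
  then have "k ` S \<inter> k ` T = k ` (S \<inter> T)"
    using sub inj_on_image_Int by metis
  moreover have "connected (k ` (S \<inter> T))"
    using ST(5) sub hkid(4) by (intro connected_continuous_image) (auto intro: continuous_on_subset)
  ultimately have "connected_component (- (k ` S \<union> k ` T)) (k a) (k b)"
    using comp pl[OF a(1) sub(1) o(1)] pl[OF a(2) sub(2) o(2)]
    by (intro Janiszewski) (auto intro: compact_imp_closed)
  then obtain C where C: "connected C" "C \<subseteq> - (k ` S \<union> k ` T)" "k a \<in> C" "k b \<in> C"
    unfolding connected_component_def by blast
  have "connected (h ` C)"
    using C(1) hkid(5) by (intro connected_continuous_image) (auto intro: continuous_on_subset)
  moreover have "h ` C \<subseteq> S2 - (S \<union> T)"
  proof (intro image_subsetI DiffI)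
    fix z assume z: "z \<in> C"
    show "h z \<in> S2" using hkid(3) by blast
    show "h z \<notin> S \<union> T"
    proof
      assume "h z \<in> S \<union> T"
      then have "k (h z) \<in> k ` S \<union> k ` T" by blast
      then show False using z C(2) hkid(2)[of z] by auto
    qed
  qed
  moreover have "a \<in> h ` C" "b \<in> h ` C"
    using C(3,4) hkid(1) ab p by (metis Diff_iff image_eqI singletonD)+
  ultimately show ?thesis
    unfolding connected_component_def by blast
qed

text \<open>The circle looks like a straight line in \<open>N\<close>, with two sides that both
  accumulate at each of its points in \<open>N\<close>. The last clause treats only the outer side:
  the regions finally produced lie outside the discs, and \<open>z\<close> has to be reached from
  there by a path.\<close>

definition flat_nbhd :: "(complex \<Rightarrow> real^3) \<Rightarrow> real^3 \<Rightarrow> (real^3) set \<Rightarrow> bool" where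
  "flat_nbhd h z N \<longleftrightarrow> sopen N \<and> z \<in> N \<and> z \<in> h ` sphere 0 1 \<and> connected N \<and>
     connected (N \<inter> h ` sphere 0 1) \<and> connected (N - h ` cball 0 1) \<and> connected (N \<inter> h ` ball 0 1) \<and>
     N \<inter> h ` sphere 0 1 \<subseteq> closure (N - h ` cball 0 1) \<and>
     N \<inter> h ` sphere 0 1 \<subseteq> closure (N \<inter> h ` ball 0 1) \<and>
     path_connected (insert z (N - h ` cball 0 1))"

lemma flat_nbhdD:
  assumes "flat_nbhd h z N"
  shows "sopen N" "z \<in> N" "z \<in> h ` sphere 0 1" "connected N"
    "connected (N \<inter> h ` sphere 0 1)" "connected (N - h ` cball 0 1)" "connected (N \<inter> h ` ball 0 1)"
    "N \<inter> h ` sphere 0 1 \<subseteq> closure (N - h ` cball 0 1)"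
    "N \<inter> h ` sphere 0 1 \<subseteq> closure (N \<inter> h ` ball 0 1)"
    "path_connected (insert z (N - h ` cball 0 1))"
  using assms unfolding flat_nbhd_def by - ((elim conjE, assumption)+)

lemma ex_flat_nbhd:
  assumes "sphere_chart h" "sopen U" "z \<in> U" "z \<in> h ` sphere 0 1"
  shows "\<exists>N. flat_nbhd h z N \<and> N \<subseteq> U"
  using assms
  by (rule chart_circle_flat_neighbourhood)
    (rule exI, unfold flat_nbhd_def, intro conjI assms, assumption+)

lemma chart_disc_split:
  assumes "sphere_chart h"
  shows "h ` cball 0 1 = h ` ball 0 1 \<union> h ` sphere 0 1" "h ` ball 0 1 \<inter> h ` sphere 0 1 = {}"
proof -
  have "cball 0 1 = ball 0 1 \<union> sphere (0::complex) 1" by auto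
  then show "h ` cball 0 1 = h ` ball 0 1 \<union> h ` sphere 0 1" by auto
  have "ball 0 1 \<inter> sphere (0::complex) 1 = {}" by auto
  then show "h ` ball 0 1 \<inter> h ` sphere 0 1 = {}"
    by (metis assms image_Int image_empty sphere_chart_inj)
qed

lemma chart_compact_image: "sphere_chart h \<Longrightarrow> compact T \<Longrightarrow> compact (h ` T)"
  using compact_continuous_image sphere_chart_continuous by blast

lemma sopen_compact_diff: "compact T \<Longrightarrow> sopen A \<Longrightarrow> sopen (A - T)"
  by (metis Diff_eq compact_imp_closed open_Compl openin_Int_open)

lemma sopen_compl_compact: "sopen A \<Longrightarrow> compact (S2 - A)"
  by (metis closedin_compact closedin_subtopology_refl compact_sphere openin_closedin_eq
      topspace_euclidean_subtopology closedin_diff)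

lemma sopen_closure_meet: "sopen N \<Longrightarrow> A \<subseteq> S2 \<Longrightarrow> z \<in> N \<Longrightarrow> z \<in> closure A \<Longrightarrow> N \<inter> A \<noteq> {}"
proof -
  assume N: "sopen N" and A: "A \<subseteq> S2" "z \<in> N" "z \<in> closure A"
  obtain T where T: "open T" "N = S2 \<inter> T" using N openin_open by blast
  then have "T \<inter> A \<noteq> {}" using A open_Int_closure_eq_empty[of T A] by blast
  then show "N \<inter> A \<noteq> {}" using T A by blast
qed

lemma connected_sopen_cover:
  assumes "connected T" "sopen X" "sopen Y" "X \<inter> Y = {}" "T \<subseteq> X \<union> Y"
  shows "T \<subseteq> X \<or> T \<subseteq> Y"
proof -
  obtain A B where AB: "open A" "X = S2 \<inter> A" "open B" "Y = S2 \<inter> B"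
    using assms(2,3) by (meson openin_open)
  have "T \<subseteq> S2" using AB assms(5) by blast
  then have "A \<inter> T = {} \<or> B \<inter> T = {}"
    using assms AB by (intro connectedD) auto
  then show ?thesis using assms(5) AB by blast
qed

section \<open>Crosscuts of a domain and their two sides\<close>

text \<open>Only the separation properties of a classical crosscut are kept. A whole circle
  contained in \<open>U\<close> thus counts as well as an open arc, and homeomorphisms preserve the
  notion.\<close>

definition crosscut ::
  "(real^3) set \<Rightarrow> (real^3) set \<Rightarrow> (real^3) set \<Rightarrow> (real^3) set \<Rightarrow> bool" where
  "crosscut U c X Y \<longleftrightarrow> sopen X \<and> sopen Y \<and> connected X \<and> connected Y \<and> connected c \<and>
     c \<noteq> {} \<and> c \<subseteq> U \<and> X \<inter> Y = {} \<and> U - c = X \<union> Y \<and> c \<subseteq> closure X \<and> c \<subseteq> closure Y"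

lemma crosscutD:
  assumes "crosscut U c X Y"
  shows "sopen X" "sopen Y" "connected X" "connected Y" "connected c" "c \<noteq> {}" "c \<subseteq> U"
    "X \<inter> Y = {}" "U - c = X \<union> Y" "c \<subseteq> closure X" "c \<subseteq> closure Y"
  using assms unfolding crosscut_def by - ((elim conjE, assumption)+)

lemma crosscut_sym: "crosscut U c X Y \<Longrightarrow> crosscut U c Y X"
  unfolding crosscut_def by (simp add: Int_commute Un_commute)

lemma crosscut_other:
  assumes c: "crosscut U c X Y" and "connected T" "T \<subseteq> U" "T \<inter> c = {}"
  shows "T \<subseteq> X \<or> T \<subseteq> Y"
proof (rule connected_sopen_cover)
  show "T \<subseteq> X \<union> Y"
    using assms(3,4) crosscutD(9)[OF c] by blast
qed (use assms(2) crosscutD(1,2,8)[OF c] in auto)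

text \<open>A connected set off \<open>c\<close> fits into one side, so two partitions of
  \<open>U - c\<close> into sides agree up to order. This identifies the sides found geometrically,
  as inner and outer, with those found by area, as small and large.\<close>

lemma crosscut_unique:
  assumes c: "crosscut U c X Y" and d: "crosscut U c Z W"
  shows "(Z = X \<and> W = Y) \<or> (Z = Y \<and> W = X)"
proof -
  have "X \<noteq> {}" "Y \<noteq> {}" "Z \<noteq> {}" "W \<noteq> {}"
    using crosscutD(6,10,11)[OF c] crosscutD(10,11)[OF d] by auto
  moreover have "Z \<subseteq> X \<or> Z \<subseteq> Y" 
    using crosscutD(9)[OF d] by (intro crosscut_other[OF c crosscutD(3)[OF d]]) blast+
  moreover have "W \<subseteq> X \<or> W \<subseteq> Y"
    using crosscutD(9)[OF d] by (intro crosscut_other[OF c crosscutD(4)[OF d]]) blast+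
  moreover have "X \<union> Y = Z \<union> W" "X \<inter> Y = {}" "Z \<inter> W = {}"
    using crosscutD(8,9)[OF c] crosscutD(8,9)[OF d] by simp_all
  ultimately have "Z \<subseteq> X \<and> W \<subseteq> Y \<or> Z \<subseteq> Y \<and> W \<subseteq> X"
    by (smt (verit) Int_absorb1 Int_commute Un_subset_iff subset_trans sup_ge1 sup_ge2 subset_empty Int_greatest)
  then show ?thesis
    using \<open>X \<union> Y = Z \<union> W\<close> \<open>X \<inter> Y = {}\<close> by (elim disjE) (rule disjI1, blast, rule disjI2, blast)
qed

text \<open>\<open>W \<union> d\<close> is connected because \<open>W\<close> accumulates at all of
  \<open>d\<close>; it avoids \<open>c\<close> and contains \<open>d\<close>, so it lies on the side
  of \<open>c\<close> that contains \<open>d\<close>.\<close>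

lemma crosscut_nested_subset:
  assumes c: "crosscut U c X Y" and d: "crosscut U d Z W"
    and "c \<inter> d = {}" "d \<subseteq> X" "c \<subseteq> Z"
  shows "W \<subseteq> X"
proof -
  have "connected (W \<union> d)"
  proof (rule connected_intermediate_closure)
    show "connected W" "W \<subseteq> W \<union> d" "W \<union> d \<subseteq> closure W"
      using crosscutD(4,11)[OF d] closure_subset[of W] by auto
  qed
  moreover have "W \<union> d \<subseteq> U" "(W \<union> d) \<inter> c = {}"
    using crosscutD(7,8,9)[OF d] assms(3,5) by blast+
  ultimately have "W \<union> d \<subseteq> X \<or> W \<union> d \<subseteq> Y"
    using crosscut_other[OF c] by blast
  then show ?thesis
    using crosscutD(6)[OF d] crosscutD(8)[OF c] assms(4) by blast
qed

text \<open>The picture is a strip cut by two disjoint lines: in order, \<open>Y\<close>,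
  \<open>c\<close>, \<open>X \<inter> Z\<close>, \<open>d\<close>, \<open>W\<close>. The middle
  piece is nonempty since \<open>Z\<close> accumulates at \<open>d\<close>, which lies in the open
  set \<open>X\<close>.\<close>

lemma crosscut_nested:
  assumes c: "crosscut U c X Y" and d: "crosscut U d Z W"
    and *: "c \<inter> d = {}" "d \<subseteq> X" "c \<subseteq> Z"
  shows "W \<subseteq> X" "Y \<subseteq> Z" "X \<inter> Z \<noteq> {}" "X \<union> Z = U"
proof -
  show W: "W \<subseteq> X" using crosscut_nested_subset[OF c d *] .
  show Y: "Y \<subseteq> Z" using crosscut_nested_subset[OF d c _ *(3,2)] *(1) by blast
  obtain x where x: "x \<in> d" using crosscutD(6)[OF d] by blast
  show "X \<inter> Z \<noteq> {}"
  proof (rule sopen_closure_meet)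
    show "sopen X" using crosscutD(1)[OF c] .
    show "Z \<subseteq> S2" using crosscutD(1)[OF d] openin_imp_subset by blast
    show "x \<in> X" "x \<in> closure Z" using x *(2) crosscutD(10)[OF d] by blast+
  qed
  show "X \<union> Z = U"
    using crosscutD(7,9)[OF c] crosscutD(9)[OF d] Y *(3) by blast
qed

lemma crosscut_image:
  assumes f: "homeomorphism S2 S2 f g" and U: "f ` U = U" and c: "crosscut U c X Y"
  shows "crosscut U (f ` c) (f ` X) (f ` Y)"
proof -
  note C = crosscutD[OF c]
  have sub: "X \<subseteq> S2" "Y \<subseteq> S2" using C(1,2) openin_imp_subset by blast+
  have cont: "continuous_on S2 f" using f homeomorphism_cont1 by blast
  have inj: "inj_on f S2" using f by (metis homeomorphism_def inj_on_inverseI)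
  have "closure X \<subseteq> S2" using sub(1) by (rule closure_minimal) simp
  then have cS: "c \<subseteq> S2" using C(10) by blast
  then have US: "U \<subseteq> S2" using C(7,9) sub by blast
  have cl: "f ` c \<subseteq> closure (f ` A)" if "c \<subseteq> closure A" "A \<subseteq> S2" for A
  proof -
    have "closure A \<subseteq> S2" using that(2) by (rule closure_minimal) simp
    then have "continuous_on (closure A) f" using cont continuous_on_subset by blast
    then have "f ` closure A \<subseteq> closure (f ` A)"
      by (rule image_closure_subset[OF _ closed_closure closure_subset])
    then show ?thesis using that by blast
  qed
  show ?thesis
    unfolding crosscut_def
  proof (intro conjI)
    show "sopen (f ` X)" "sopen (f ` Y)"
      using C(1,2) homeomorphism_imp_open_map[OF f] by blast+
    show "connected (f ` X)" "connected (f ` Y)" "connected (f ` c)"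
      using C(3-5) sub cS continuous_on_subset[OF cont]
      by (auto intro!: connected_continuous_image)
    show "f ` c \<noteq> {}" using C(6) by blast
    show "f ` c \<subseteq> U" using C(7) U by blast
    show "f ` X \<inter> f ` Y = {}"
      using inj_on_image_Int[OF inj sub] C(8) by simp
    have "f ` (U - c) = f ` U - f ` c"
      using US cS by (intro inj_on_image_set_diff[OF inj]) auto
    then show "U - f ` c = f ` X \<union> f ` Y"
      using C(9) U by (simp add: image_Un)
    show "f ` c \<subseteq> closure (f ` X)" "f ` c \<subseteq> closure (f ` Y)"
      using cl C(10,11) sub by blast+
  qed
qed

text \<open>The function \<open>s\<close> selects the inner or the outer part of a flat
  neighbourhood, so that one argument serves both sides. Selected parts at nearby points overlap,
  and connectedness of \<gamma> carries the same component of \<open>U - \<gamma>\<close> along all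
  of \<gamma>.\<close>

lemma flat_side:
  assumes U: "sopen U" and \<gamma>: "\<gamma> \<in> components (U \<inter> h ` sphere 0 1)" and h: "sphere_chart h"
    and s: "\<And>z N. flat_nbhd h z N \<Longrightarrow> N \<subseteq> U \<Longrightarrow>
        connected (s N) \<and> s N \<subseteq> N - h ` sphere 0 1 \<and> N \<inter> h ` sphere 0 1 \<subseteq> closure (s N)"
    and mono: "\<And>M N. s M \<inter> N \<subseteq> s N"
  obtains C where "C \<in> components (U - \<gamma>)"
    "\<And>z N. z \<in> \<gamma> \<Longrightarrow> flat_nbhd h z N \<Longrightarrow> N \<subseteq> U \<Longrightarrow> s N \<subseteq> C"
proof -
  have con: "connected \<gamma>" and g: "\<gamma> \<noteq> {}" "\<gamma> \<subseteq> U" "\<gamma> \<subseteq> h ` sphere 0 1"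
    using \<gamma> in_components_connected in_components_nonempty in_components_subset by blast+
  have US: "U \<subseteq> S2" using U openin_imp_subset by blast
  have overlap: "s M \<inter> s N \<noteq> {}"
    if "flat_nbhd h z N" "N \<subseteq> U" "z' \<in> N" "flat_nbhd h z' M" "M \<subseteq> U" for z z' M N
  proof -
    have "z' \<in> closure (s M)" "s M \<subseteq> S2" "sopen N"
      using s[OF that(4,5)] flat_nbhdD(1)[OF that(1)] flat_nbhdD(2,3)[OF that(4)] that(5) US
      by blast+
    then have "N \<inter> s M \<noteq> {}"
      using that(3) sopen_closure_meet by blast
    then show ?thesis using mono by blast
  qed
  have comp: "\<exists>C. C \<in> components (U - \<gamma>) \<and> s N \<subseteq> C" if "flat_nbhd h z N" "N \<subseteq> U" for z N
  proof (rule exists_component_superset)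
    show "s N \<subseteq> U - \<gamma>" using s[OF that] g that by blast
    have "s N \<noteq> {}" using overlap[OF that _ that] flat_nbhdD(2)[OF that(1)] by blast
    then show "U - \<gamma> \<noteq> {}" using \<open>s N \<subseteq> U - \<gamma>\<close> by blast
    show "connected (s N)" using s[OF that] by blast
  qed
  have join: "s M \<subseteq> C" if "flat_nbhd h z N" "N \<subseteq> U" "z' \<in> N" "flat_nbhd h z' M" "M \<subseteq> U"
      "C \<in> components (U - \<gamma>)" "s N \<subseteq> C" for z z' M N C
  proof (rule components_maximal[OF that(6)])
    show "connected (s M)" "s M \<subseteq> U - \<gamma>" using s[OF that(4,5)] that(5) g(3) by blast+
    show "C \<inter> s M \<noteq> {}" using overlap[OF that(1-5)] that(7) by blast
  qed
  have "\<exists>N. flat_nbhd h z N \<and> N \<subseteq> U" if "z \<in> \<gamma>" for z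
    by (rule ex_flat_nbhd[OF h U]) (use g that in blast)+
  then obtain N where N: "\<And>z. z \<in> \<gamma> \<Longrightarrow> flat_nbhd h z (N z) \<and> N z \<subseteq> U"
    by metis
  have zN: "z \<in> N z" if "z \<in> \<gamma>" for z
    using N[OF that] flat_nbhdD(2) by blast
  have ne: "s (N z) \<noteq> {}" if "z \<in> \<gamma>" for z
    using overlap[of z "N z" z "N z"] N[OF that] zN[OF that] by blast
  \<comment> \<open>The classes of this relation are relatively open in \<gamma>, because a point of
    \<gamma> is related to all points of \<gamma> in its flat neighbourhood; hence there is one
    class.\<close>
  define R where "R a b \<longleftrightarrow> (\<exists>C\<in>components (U - \<gamma>). s (N a) \<subseteq> C \<and> s (N b) \<subseteq> C)" for a b
  have R: "R a b" if "a \<in> \<gamma>" "b \<in> \<gamma>" for a b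
  proof (rule connected_equivalence_relation[OF con that])
    fix x y assume "R x y" then show "R y x" unfolding R_def by blast
  next
    fix x y z assume xyz: "R x y" "R y z" "y \<in> \<gamma>"
    have "s (N y) \<noteq> {}"
      using ne[OF xyz(3)] .
    then show "R x z"
      using xyz components_eq unfolding R_def by (metis Int_greatest subset_empty)
  next
    fix a assume a: "a \<in> \<gamma>"
    obtain C where C: "C \<in> components (U - \<gamma>)" "s (N a) \<subseteq> C" using comp N[OF a] by blast
    have "R a x" if "x \<in> \<gamma> \<inter> N a" for x
      using join[of a "N a" x "N x" C] N[of a] N[of x] a that C unfolding R_def by blast
    moreover have "openin (top_of_set \<gamma>) (\<gamma> \<inter> N a)"
    proof -
      obtain T where "open T" "N a = S2 \<inter> T"
        using N[OF a] flat_nbhdD(1) openin_open by metis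
      then have "\<gamma> \<inter> N a = \<gamma> \<inter> T" using g US by blast
      then show ?thesis using \<open>open T\<close> by (simp add: openin_open_Int)
    qed
    moreover have "a \<in> \<gamma> \<inter> N a" using a zN by blast
    ultimately show "\<exists>T. openin (top_of_set \<gamma>) T \<and> a \<in> T \<and> (\<forall>x\<in>T. R a x)" by blast
  qed
  obtain a where a: "a \<in> \<gamma>" using g by blast
  obtain C where C: "C \<in> components (U - \<gamma>)" "s (N a) \<subseteq> C" using comp N[OF a] by blast
  show thesis
  proof (rule that[OF C(1)])
    fix z M assume z: "z \<in> \<gamma>" and M: "flat_nbhd h z M" "M \<subseteq> U"
    have "s (N z) \<subseteq> C"
      using R[OF a z] C components_eq ne[OF a] unfolding R_def by (metis Int_greatest subset_empty)
    then show "s M \<subseteq> C"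
      using join[of z "N z" z M C] N[OF z] zN[OF z] M C(1) by blast
  qed
qed

text \<open>Along \<gamma> there is one adjacent component \<open>X\<close> outside the circle and
  one adjacent component \<open>Y\<close> inside. Far from \<gamma> either may cross the circle
  again, so the second conclusion speaks only of flat neighbourhoods.\<close>

lemma chart_crosscut:
  assumes h: "sphere_chart h" and U: "sopen U" "connected U" "connected (S2 - U)"
    and \<gamma>: "\<gamma> \<in> components (U \<inter> h ` sphere 0 1)"
  obtains X Y where "crosscut U \<gamma> X Y"
    "\<And>z N. z \<in> \<gamma> \<Longrightarrow> flat_nbhd h z N \<Longrightarrow> N \<subseteq> U \<Longrightarrow> N - h ` cball 0 1 \<subseteq> X \<and> N \<inter> h ` ball 0 1 \<subseteq> Y"
proof -
  let ?c = "h ` sphere 0 1" and ?B = "h ` cball 0 1" and ?I = "h ` ball 0 1" and ?K = "S2 - U"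
  have con: "connected \<gamma>" and g: "\<gamma> \<noteq> {}" "\<gamma> \<subseteq> U" "\<gamma> \<subseteq> ?c"
    using \<gamma> in_components_connected in_components_nonempty in_components_subset by blast+
  have US: "U \<subseteq> S2" using U openin_imp_subset by blast
  note split = chart_disc_split[OF h]
  obtain X where X: "X \<in> components (U - \<gamma>)"
      "\<And>z N. z \<in> \<gamma> \<Longrightarrow> flat_nbhd h z N \<Longrightarrow> N \<subseteq> U \<Longrightarrow> N - ?B \<subseteq> X"
  proof (rule flat_side[OF U(1) \<gamma> h, of "\<lambda>N. N - ?B"])
    show "connected (N - ?B) \<and> N - ?B \<subseteq> N - ?c \<and> N \<inter> ?c \<subseteq> closure (N - ?B)"
      if "flat_nbhd h z N" for z N
      using flat_nbhdD(6,8)[OF that] split by blast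
  qed blast+
  obtain Y where Y: "Y \<in> components (U - \<gamma>)"
      "\<And>z N. z \<in> \<gamma> \<Longrightarrow> flat_nbhd h z N \<Longrightarrow> N \<subseteq> U \<Longrightarrow> N \<inter> ?I \<subseteq> Y"
  proof (rule flat_side[OF U(1) \<gamma> h, of "\<lambda>N. N \<inter> ?I"])
    show "connected (N \<inter> ?I) \<and> N \<inter> ?I \<subseteq> N - ?c \<and> N \<inter> ?c \<subseteq> closure (N \<inter> ?I)"
      if "flat_nbhd h z N" for z N
      using flat_nbhdD(7,9)[OF that] split by blast
  qed blast+
  have Nc: "N \<inter> ?c \<subseteq> \<gamma>" if "z \<in> \<gamma>" "flat_nbhd h z N" "N \<subseteq> U" for z N
    using that g(3) flat_nbhdD(2,5)[OF that(2)] by (intro components_maximal[OF \<gamma>]) auto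
  have exN: "\<exists>N. flat_nbhd h z N \<and> N \<subseteq> U" if "z \<in> \<gamma>" for z
    by (rule ex_flat_nbhd[OF h U(1)]) (use g that in blast)+
  have "closedin (top_of_set (U \<inter> ?c)) \<gamma>" using \<gamma> closedin_component by blast
  moreover have "closedin (top_of_set U) (U \<inter> ?c)"
    using chart_compact_image[OF h] by (simp add: closedin_closed_Int compact_imp_closed)
  ultimately have clo: "closedin (top_of_set U) \<gamma>" using closedin_trans by blast
  then have "openin (top_of_set U) (U - \<gamma>)" by (simp add: openin_diff)
  then have op: "sopen (U - \<gamma>)" using U(1) openin_trans by blast
  \<comment> \<open>A flat neighbourhood of a point of \<gamma> meets the circle in points of
    \<gamma> only, so the remaining components of the circle in \<open>U\<close> do not accumulate
    at \<gamma>. This makes \<open>?T\<close> below compact.\<close>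
  have op2: "sopen (U - (?c - \<gamma>))"
  proof (subst openin_subopen, intro ballI)
    fix x assume x: "x \<in> U - (?c - \<gamma>)"
    show "\<exists>T. sopen T \<and> x \<in> T \<and> T \<subseteq> U - (?c - \<gamma>)"
    proof (cases "x \<in> \<gamma>")
      case True
      then obtain N where N: "flat_nbhd h x N" "N \<subseteq> U" using exN by blast
      then show ?thesis
        using Nc[OF True N] N(2) flat_nbhdD(1,2)[OF N(1)] by blast
    next
      case False
      then have "x \<in> U - ?c" using x by blast
      then show ?thesis
        using sopen_compact_diff[OF chart_compact_image[OF h compact_sphere] U(1)] by blast
    qed
  qed
  have "X \<noteq> Y"
  proof
    assume eq: "X = Y"
    obtain z where z: "z \<in> \<gamma>" using g by blast
    then obtain N where N: "flat_nbhd h z N" "N \<subseteq> U" using exN by blast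
    have N': "sopen N" "z \<in> N" "connected N" "z \<in> closure (N - ?B)" "z \<in> closure (N \<inter> ?I)"
      using flat_nbhdD(1,2,3,4,8,9)[OF N(1)] by blast+
    then obtain a b where ab: "a \<in> N - ?B" "b \<in> N \<inter> ?I"
      by (metis closure_empty empty_iff ex_in_conv)
    have Xab: "a \<in> X" "b \<in> X" using X(2)[OF z N] Y(2)[OF z N] ab eq by blast+
    \<comment> \<open>If \<open>X = Y\<close>, then \<open>a\<close> and \<open>b\<close> are joined
      off \<open>?S\<close> within \<open>X\<close>, and off \<open>?T\<close> within
      \<open>N\<close>. The two compact sets share just the connected complement of
      \<open>U\<close>, so Janiszewski's theorem joins \<open>a\<close> to \<open>b\<close> off the
      whole circle, although the circle separates them.\<close>
    let ?S = "\<gamma> \<union> ?K" and ?T = "(?c - \<gamma>) \<union> ?K"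
    have S: "?S = S2 - (U - \<gamma>)" and T: "?T = S2 - (U - (?c - \<gamma>))"
      using g US sphere_chart_subset[OF h] by blast+
    have "connected_component (S2 - (?S \<union> ?T)) a b"
    proof (rule Janiszewski_sphere)
      show "compact ?S" "compact ?T" unfolding S T using op op2 sopen_compl_compact by blast+
      show "?S \<subseteq> S2" "?T \<subseteq> S2" unfolding S T by blast+
      have "?S \<inter> ?T = ?K" using g by blast
      then show "connected (?S \<inter> ?T)" using U(3) by simp
      have "X \<subseteq> S2 - ?S" using X(1) in_components_subset US by blast
      then show "connected_component (S2 - ?S) a b"
        using in_components_connected[OF X(1)] Xab unfolding connected_component_def by blast
      have "N \<subseteq> S2 - ?T" using Nc[OF z N] N(2) US by blast
      then show "connected_component (S2 - ?T) a b"
        using N'(3) ab unfolding connected_component_def by blast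
    qed
    then obtain Z where Z: "connected Z" "Z \<subseteq> S2 - (?S \<union> ?T)" "a \<in> Z" "b \<in> Z"
      unfolding connected_component_def by blast
    have "sopen (S2 - ?B)"
      by (rule sopen_compact_diff[OF chart_compact_image[OF h compact_cball]]) simp
    moreover have "sopen ?I" using sphere_chart_open[OF h] by blast
    moreover have "?I \<inter> (S2 - ?B) = {}" "Z \<subseteq> ?I \<union> (S2 - ?B)"
      using split Z(2) g by blast+
    ultimately have "Z \<subseteq> ?I \<or> Z \<subseteq> S2 - ?B"
      using connected_sopen_cover[OF Z(1)] by blast
    moreover have "?I \<subseteq> ?B" using split(1) by blast
    ultimately show False using Z(3,4) ab by blast
  qed
  \<comment> \<open>No third component exists: each one adheres to some point of \<gamma>, and there
    a flat neighbourhood has room only for \<open>X\<close> and \<open>Y\<close>.\<close>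
  have cover: "U - \<gamma> \<subseteq> X \<union> Y"
  proof
    fix x assume x: "x \<in> U - \<gamma>"
    define C where "C = connected_component_set (U - \<gamma>) x"
    have C: "C \<in> components (U - \<gamma>)" "x \<in> C"
      unfolding C_def using componentsI[OF x] connected_component_refl[OF x] by simp_all
    have "closure C \<inter> \<gamma> \<noteq> {}"
      by (rule component_diff_adheres[OF sopen_imp_locally_connected[OF U(1)] U(2) clo g(1) C(1)])
    then obtain z where z: "z \<in> closure C" "z \<in> \<gamma>" by blast
    then obtain N where N: "flat_nbhd h z N" "N \<subseteq> U" using exN by blast
    have Csub: "C \<subseteq> U - \<gamma>" using C in_components_subset by blast
    then have "N \<inter> C \<noteq> {}"
      using N z US by (intro sopen_closure_meet[of N C z]) (auto dest: flat_nbhdD)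
    then obtain w where w: "w \<in> N" "w \<in> C" by blast
    have "w \<notin> ?c" using w Nc[OF z(2) N] Csub by blast
    then have "w \<in> N - ?B \<or> w \<in> N \<inter> ?I" using w split by blast
    then have "w \<in> X \<or> w \<in> Y" using X(2)[OF z(2) N] Y(2)[OF z(2) N] by blast
    then have "C = X \<or> C = Y"
      using components_eq[OF C(1) X(1)] components_eq[OF C(1) Y(1)] w by blast
    then show "x \<in> X \<union> Y" using C by blast
  qed
  show thesis
  proof (rule that[of X Y])
    show "crosscut U \<gamma> X Y"
      unfolding crosscut_def
    proof (intro conjI)
      show "sopen X" "sopen Y"
        using sopen_component[OF op X(1)] sopen_component[OF op Y(1)] by simp_all
      show "connected X" "connected Y" "connected \<gamma>" "\<gamma> \<noteq> {}" "\<gamma> \<subseteq> U"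
        using in_components_connected[OF X(1)] in_components_connected[OF Y(1)] con g by simp_all
      show "X \<inter> Y = {}" using \<open>X \<noteq> Y\<close> components_nonoverlap[OF X(1) Y(1)] by blast
      show "U - \<gamma> = X \<union> Y" using cover in_components_subset[OF X(1)] in_components_subset[OF Y(1)] by blast
      show "\<gamma> \<subseteq> closure X" "\<gamma> \<subseteq> closure Y"
      proof -
        have "z \<in> closure X \<and> z \<in> closure Y" if z: "z \<in> \<gamma>" for z
        proof -
          obtain N where N: "flat_nbhd h z N" "N \<subseteq> U" using exN z by blast
          then have "z \<in> closure (N - ?B)" "z \<in> closure (N \<inter> ?I)"
            using flat_nbhdD(2,3,8,9)[OF N(1)] by blast+
          then show ?thesis
            using closure_mono[of "N - ?B" X] closure_mono[of "N \<inter> ?I" Y] X(2)[OF z N] Y(2)[OF z N]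
            by blast
        qed
        then show "\<gamma> \<subseteq> closure X" "\<gamma> \<subseteq> closure Y" by blast+
      qed
    qed
  qed (use X Y in blast)
qed

section \<open>Areas of the sides of a crosscut\<close>

lemma finite_measure_sphere_area: "finite_measure sphere_area"
  by (rule finite_measureI) (simp add: space_sphere_area emeasure_sphere_area_S2)

lemma sopen_sets: "sopen A \<Longrightarrow> A \<in> sets sphere_area"
  unfolding sets_sphere_area openin_open sets_restrict_space by (metis borel_open imageI)

abbreviation area :: "(real^3) set \<Rightarrow> real" where
  "area \<equiv> measure sphere_area"

lemma area_mono: "A \<subseteq> B \<Longrightarrow> sopen A \<Longrightarrow> sopen B \<Longrightarrow> area A \<le> area B"
  by (intro finite_measure.finite_measure_mono[OF finite_measure_sphere_area] sopen_sets)

lemma area_Un_Int: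
  assumes "sopen A" "sopen B"
  shows "area (A \<union> B) + area (A \<inter> B) = area A + area B"
proof -
  interpret finite_measure sphere_area by (rule finite_measure_sphere_area)
  note s = assms[THEN sopen_sets]
  have "area (A \<union> B) = area A + area (B - A)"
    using finite_measure_Union[of A "B - A"] s by (simp add: sets.Diff Un_Diff_cancel)
  moreover have "area B = area (A \<inter> B) + area (B - A)"
  proof -
    have "A \<inter> B \<union> (B - A) = B" by blast
    then show ?thesis
      using finite_measure_Union[of "A \<inter> B" "B - A"] s by (simp add: sets.Diff sets.Int) blast
  qed
  ultimately show ?thesis by simp
qed

text \<open>The cone over \<open>A\<close> contains a nonempty open set, namely its part in the open
  unit ball, and nonempty open sets have positive volume.\<close>

lemma area_pos:
  assumes "sopen A" "A \<noteq> {}"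
  shows "area A > 0"
proof -
  interpret finite_measure sphere_area by (rule finite_measure_sphere_area)
  obtain T where T: "open T" "A = S2 \<inter> T" using assms(1) openin_open by metis
  let ?C = "{x. x \<noteq> 0 \<and> norm x < 1 \<and> x /\<^sub>R norm x \<in> T}"
  have "?C = (- {0} \<inter> ball 0 1) \<inter> (\<lambda>x. x /\<^sub>R norm x) -` T"
    by (auto simp: dist_norm)
  moreover have "open ((- {0} \<inter> ball (0::real^3) 1) \<inter> (\<lambda>x. x /\<^sub>R norm x) -` T)"
    using T(1) by (intro continuous_open_preimage continuous_intros) auto
  ultimately have oC: "open ?C" by simp
  obtain a where a: "a \<in> A" using assms(2) by blast
  then have "norm a = 1" "a \<in> T" using T by auto
  then have "(1/2) *\<^sub>R a \<in> ?C" by auto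
  then have "?C \<noteq> {}" by blast
  then have neg: "\<not> negligible ?C" using oC open_not_negligible by blast
  have sub: "?C \<subseteq> {x. x \<noteq> 0 \<and> norm x \<le> 1 \<and> x /\<^sub>R norm x \<in> A}"
    using T by auto
  have pos: "emeasure lborel ?C \<noteq> 0"
  proof
    assume "emeasure lborel ?C = 0"
    then have "?C \<in> null_sets lborel" using oC by (simp add: null_sets_def)
    then show False using neg negligible_iff_null_sets null_sets_completionI by blast
  qed
  have bor: "{x. x \<noteq> 0 \<and> norm x \<le> 1 \<and> x /\<^sub>R norm x \<in> A} \<in> sets lborel"
  proof -
    have "{x. x \<noteq> 0 \<and> norm x \<le> 1 \<and> x /\<^sub>R norm x \<in> A} =
        (- {0} \<inter> cball 0 1) \<inter> (\<lambda>x. x /\<^sub>R norm x) -` T"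
      using T by (auto simp: dist_norm)
    moreover have "(\<lambda>x::real^3. x /\<^sub>R norm x) -` T \<in> sets borel"
      using measurable_sets_borel[of "\<lambda>x::real^3. x /\<^sub>R norm x" borel T] T(1) by simp
    ultimately show ?thesis by auto
  qed
  have "emeasure sphere_area A \<noteq> 0"
    unfolding emeasure_sphere_area[OF sopen_sets[OF assms(1)]]
    using pos emeasure_mono[OF sub bor] by auto
  then show ?thesis
    using emeasure_eq_measure by (metis ennreal_0 measure_nonneg order_le_less)
qed

text \<open>Preservation is formulated with preimages; injectivity of \<open>f\<close> on the sphere
  identifies \<open>A\<close> with the preimage of its image.\<close>

lemma area_image:
  assumes f: "homeomorphism S2 S2 f g" "area_preserving f" and A: "sopen A"
  shows "area (f ` A) = area A"
proof -
  have AS: "A \<subseteq> S2" using A openin_imp_subset by blast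
  have "sopen (f ` A)" using homeomorphism_imp_open_map[OF f(1) A] .
  moreover have "f -` (f ` A) \<inter> S2 = A"
  proof
    show "A \<subseteq> f -` (f ` A) \<inter> S2" using AS by blast
    show "f -` (f ` A) \<inter> S2 \<subseteq> A"
    proof
      fix x assume x: "x \<in> f -` (f ` A) \<inter> S2"
      then obtain y where "y \<in> A" "f x = f y" by blast
      then show "x \<in> A"
        using x AS homeomorphism_apply1[OF f(1)] by (metis IntD2 subsetD)
    qed
  qed
  ultimately have "emeasure sphere_area A = emeasure sphere_area (f ` A)"
    using f(2) sopen_sets[of "f ` A"] unfolding area_preserving_def by metis
  then show ?thesis by (simp add: measure_def)
qed

text \<open>The middle strip \<open>X \<inter> Z\<close> is nonempty and open, hence of positive
  area. It lies in \<open>X\<close> beside \<open>W\<close> and in \<open>Z\<close> beside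
  \<open>Y\<close>, and is counted twice in the sum of the areas of \<open>X\<close> and
  \<open>Z\<close>.\<close>

lemma crosscut_area_less:
  assumes c: "crosscut U c X Y" and d: "crosscut U d Z W"
    and *: "c \<inter> d = {}" "d \<subseteq> X" "c \<subseteq> Z"
  shows "area W < area X" "area Y < area Z" "area U < area X + area Z"
proof -
  note n = crosscut_nested[OF c d *] and c' = crosscutD[OF c] and d' = crosscutD[OF d]
  have o: "sopen (X \<inter> Z)" using c'(1) d'(1) by (rule openin_Int)
  have pos: "area (X \<inter> Z) > 0" using area_pos[OF o n(3)] .
  have dis: "W \<inter> (X \<inter> Z) = {}" "Y \<inter> (X \<inter> Z) = {}" using c'(8) d'(8) by blast+
  have "area (W \<union> (X \<inter> Z)) = area W + area (X \<inter> Z)" "area (Y \<union> (X \<inter> Z)) = area Y + area (X \<inter> Z)"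
    using area_Un_Int[OF d'(2) o] area_Un_Int[OF c'(2) o] dis by simp_all
  moreover have "area (W \<union> (X \<inter> Z)) \<le> area X" "area (Y \<union> (X \<inter> Z)) \<le> area Z"
    using n c' d' o by (auto intro!: area_mono)
  ultimately show "area W < area X" "area Y < area Z" using pos by simp_all
  show "area U < area X + area Z"
    using area_Un_Int[OF c'(1) d'(1)] n(4) pos by simp
qed

text \<open>\<open>D\<close> is the small side of the crosscut \<open>c\<close> and \<open>G\<close> the large one.\<close>

definition cut :: "(real^3) set \<Rightarrow> (real^3) set \<Rightarrow> (real^3) set \<Rightarrow> (real^3) set \<Rightarrow> bool" where
  "cut U c D G \<longleftrightarrow> crosscut U c D G \<and> area U / 2 < area G"

lemma cut_small:
  assumes "cut U c D G" "sopen U"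
  shows "area D < area U / 2"
proof -
  have c: "crosscut U c D G" and G: "area U / 2 < area G" using assms(1) by (simp_all add: cut_def)
  note d = crosscutD[OF c]
  have "area (D \<union> G) = area D + area G" using area_Un_Int[OF d(1,2)] d(8) by simp
  moreover have "area (D \<union> G) \<le> area U"
    using d(1,2,9) assms(2) by (intro area_mono) auto
  ultimately show ?thesis using G by simp
qed

lemma cut_image:
  assumes "homeomorphism S2 S2 f g" "area_preserving f" "f ` U = U" "cut U c D G"
  shows "cut U (f ` c) (f ` D) (f ` G)"
proof -
  have c: "crosscut U c D G" "area U / 2 < area G" using assms(4) by (simp_all add: cut_def)
  then show ?thesis
    using crosscut_image[OF assms(1,3) c(1)] area_image[OF assms(1,2) crosscutD(2)[OF c(1)]]
    unfolding cut_def by simp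
qed

text \<open>The side of \<open>c\<close> containing its image and the side of the image containing
  \<open>c\<close> overlap and cover \<open>U\<close>, so their areas add up to more than that of
  \<open>U\<close>. If both sides of \<open>c\<close> had at most half the area, then by
  preservation so would both sides of the image.\<close>

lemma crosscut_imp_cut:
  assumes f: "homeomorphism S2 S2 f g" "area_preserving f" "f ` U = U"
    and c: "crosscut U c X Y" and "c \<inter> f ` c = {}"
  shows "cut U c X Y \<or> cut U c Y X"
proof (rule ccontr)
  assume "\<not> ?thesis"
  then have half: "area X \<le> area U / 2" "area Y \<le> area U / 2"
    using c crosscut_sym[OF c] unfolding cut_def by auto
  have d: "crosscut U (f ` c) (f ` X) (f ` Y)" using crosscut_image[OF f(1,3) c] .
  have half': "area (f ` X) \<le> area U / 2" "area (f ` Y) \<le> area U / 2"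
    using half area_image[OF f(1,2)] crosscutD(1,2)[OF c] by simp_all
  have key: False if "crosscut U c X' Y'" "crosscut U (f ` c) Z W" "f ` c \<subseteq> X'" "c \<subseteq> Z"
      "area X' \<le> area U / 2" "area Z \<le> area U / 2" for X' Y' Z W
    using crosscut_area_less(3)[OF that(1,2) assms(5) that(3,4)] that(5,6) by simp
  have "f ` c \<subseteq> X \<or> f ` c \<subseteq> Y"
    using crosscut_other[OF c crosscutD(5,7)[OF d]] assms(5) by blast
  moreover have "c \<subseteq> f ` X \<or> c \<subseteq> f ` Y"
    using crosscut_other[OF d crosscutD(5,7)[OF c]] assms(5) by blast
  ultimately show False
    using key[OF c d] key[OF c crosscut_sym[OF d]] key[OF crosscut_sym[OF c] d]
      key[OF crosscut_sym[OF c] crosscut_sym[OF d]] half half' by metis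
qed

text \<open>Small sides can only nest: were \<open>d\<close> inside \<open>D\<close>, the large side
  \<open>G\<close> would fit into the small side \<open>D'\<close>. So \<open>d\<close> lies in
  \<open>G\<close>, and \<open>D\<close> is contained in \<open>D'\<close> with a strip to
  spare.\<close>

lemma cut_area_less:
  assumes U: "sopen U" and c: "cut U c D G" and d: "cut U d D' G'" and "c \<inter> d = {}" "c \<subseteq> D'"
  shows "area D < area D'"
proof -
  have cc: "crosscut U c D G" and dc: "crosscut U d D' G'"
    and G: "area U / 2 < area G" using c d by (simp_all add: cut_def)
  have "d \<subseteq> D \<or> d \<subseteq> G"
    using crosscut_other[OF cc crosscutD(5,7)[OF dc]] assms(4) by blast
  then show ?thesis
  proof
    assume "d \<subseteq> D"
    then have "area G < area D'"
      using crosscut_area_less(2)[OF cc dc assms(4)] assms(5) by blast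
    then show ?thesis using G cut_small[OF d U] by simp
  next
    assume "d \<subseteq> G"
    then show ?thesis
      using crosscut_area_less(2)[OF crosscut_sym[OF cc] dc assms(4)] assms(5) by blast
  qed
qed

section \<open>The region adjacent to three crosscuts\<close>

lemma sopen_path_connected: "sopen W \<Longrightarrow> connected W \<Longrightarrow> path_connected W"
  unfolding path_connected_component connected_iff_connected_component
  by (metis locally_open_subset locally_path_connected_sphere path_component_eq_connected_component)

lemma flat_nbhd_nonempty:
  assumes "flat_nbhd h z N"
  shows "N - h ` cball 0 1 \<noteq> {}" "N \<inter> h ` ball 0 1 \<noteq> {}"
proof -
  have "z \<in> closure (N - h ` cball 0 1)" "z \<in> closure (N \<inter> h ` ball 0 1)"
    using flat_nbhdD(2,3,8,9)[OF assms] by blast+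
  then show "N - h ` cball 0 1 \<noteq> {}" "N \<inter> h ` ball 0 1 \<noteq> {}"
    by (metis closure_empty empty_iff)+
qed

text \<open>\<open>W\<close> is grown from the large side of \<open>\<gamma> i\<close>. If it failed
  to adhere to some \<open>\<gamma> k\<close>, a crosscut in the closure of \<open>W\<close> would
  have \<open>W\<close> on one side and \<open>\<gamma> k\<close> on the other, and
  \<open>cut_area_less\<close> would contradict the maximality expressed by
  \<open>M\<close>.\<close>

lemma ex_central_region:
  fixes h :: "nat \<Rightarrow> complex \<Rightarrow> real^3"
  assumes h: "\<And>j. j \<in> J \<Longrightarrow> sphere_chart (h j)"
    and disj: "\<And>j k. j \<in> J \<Longrightarrow> k \<in> J \<Longrightarrow> j \<noteq> k \<Longrightarrow> h j ` cball 0 1 \<inter> h k ` cball 0 1 = {}"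
    and J: "finite J" "i \<in> J" "i' \<in> J" "i \<noteq> i'"
    and U: "sopen U" "connected U" "connected (S2 - U)"
    and M: "\<And>k c. k \<in> J \<Longrightarrow> c \<in> components (U \<inter> h k ` sphere 0 1) \<Longrightarrow> \<exists>D G. cut U c D G \<and> area D \<le> M"
    and \<gamma>: "\<And>j. j \<in> J \<Longrightarrow> \<gamma> j \<in> components (U \<inter> h j ` sphere 0 1)"
    and cutj: "\<And>j. j \<in> J \<Longrightarrow> cut U (\<gamma> j) (D j) (G j)"
    and areaj: "\<And>j. j \<in> J \<Longrightarrow> area (D j) = M"
  obtains W where "sopen W" "connected W" "W \<noteq> {}" "W \<subseteq> U" "\<And>j. j \<in> J \<Longrightarrow> W \<inter> h j ` cball 0 1 = {}"
    "\<And>j. j \<in> J \<Longrightarrow> \<exists>z\<in>\<gamma> j. path_connected (insert z W)"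
proof -
  define c where "c j = h j ` sphere 0 1" for j
  define B where "B j = h j ` cball 0 1" for j
  define I where "I j = h j ` ball 0 1" for j
  define V where "V = U - (\<Union>j\<in>J. c j)"
  have US: "U \<subseteq> S2" using U(1) openin_imp_subset by blast
  have BIc: "B j = I j \<union> c j" "I j \<inter> c j = {}" if "j \<in> J" for j
    using chart_disc_split[OF h[OF that]] by (simp_all add: B_def I_def c_def)
  have cB: "c j \<subseteq> B j" for j unfolding c_def B_def by auto
  have compB: "compact (B j)" "compact (c j)" if "j \<in> J" for j
    using chart_compact_image[OF h[OF that]] by (simp_all add: B_def c_def)
  have cdisj: "c j \<inter> c k = {}" if "j \<in> J" "k \<in> J" "j \<noteq> k" for j k
    using disj[OF that] cB[of j] cB[of k] unfolding B_def by blast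
  have oV: "sopen V"
  proof -
    have "compact (\<Union>j\<in>J. c j)" using J(1) compB(2) by (intro compact_UN) auto
    then show ?thesis unfolding V_def using U(1) by (rule sopen_compact_diff)
  qed
  have \<gamma>sub: "\<gamma> j \<subseteq> U" "\<gamma> j \<subseteq> c j" "connected (\<gamma> j)" "\<gamma> j \<noteq> {}" if "j \<in> J" for j
    using in_components_subset[OF \<gamma>[OF that]] in_components_connected[OF \<gamma>[OF that]]
      in_components_nonempty[OF \<gamma>[OF that]] unfolding c_def by auto
  \<comment> \<open>Removing the other circles, which are compact and disjoint from
    \<open>c j\<close>, before choosing \<open>N\<close> makes both open sides of \<open>N\<close>
    avoid all circles.\<close>
  have flat: "\<exists>N. flat_nbhd (h j) z N \<and> N \<subseteq> U \<and> N \<inter> c j \<subseteq> \<delta> \<and> N - B j \<subseteq> V \<and> N \<inter> I j \<subseteq> V"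
    if j: "j \<in> J" and \<delta>: "\<delta> \<in> components (U \<inter> c j)" and z: "z \<in> \<delta>" for j \<delta> z
  proof -
    have zUc: "z \<in> U" "z \<in> c j" using z in_components_subset[OF \<delta>] by auto
    have "compact (\<Union>k\<in>J-{j}. c k)" using J(1) compB(2) by (intro compact_UN) auto
    then have "sopen (U - (\<Union>k\<in>J-{j}. c k))" using U(1) by (rule sopen_compact_diff)
    moreover have "z \<in> U - (\<Union>k\<in>J-{j}. c k)" using zUc cdisj j by blast
    ultimately obtain N where N: "flat_nbhd (h j) z N" "N \<subseteq> U - (\<Union>k\<in>J-{j}. c k)"
      using ex_flat_nbhd[OF h[OF j]] zUc(2) c_def by metis
    have "N \<inter> c j \<subseteq> \<delta>"
    proof (rule components_maximal[OF \<delta>])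
      show "connected (N \<inter> c j)" using flat_nbhdD(5)[OF N(1)] c_def by simp
      show "N \<inter> c j \<subseteq> U \<inter> c j" using N(2) by blast
      show "\<delta> \<inter> (N \<inter> c j) \<noteq> {}" using z zUc flat_nbhdD(2)[OF N(1)] by blast
    qed
    moreover have "N - B j \<subseteq> V" "N \<inter> I j \<subseteq> V"
      using N(2) cB[of j] BIc(2)[OF j] unfolding V_def by blast+
    ultimately show ?thesis using N by blast
  qed
  obtain z0 where z0: "z0 \<in> \<gamma> i" using \<gamma>sub(4)[OF J(2)] by blast
  obtain N0 where N0: "flat_nbhd (h i) z0 N0" "N0 \<subseteq> U" "N0 - B i \<subseteq> V" "N0 \<inter> I i \<subseteq> V"
    using flat[OF J(2) _ z0] \<gamma>[OF J(2)] c_def by metis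
  \<comment> \<open>The large side of \<open>\<gamma> i\<close> may begin inside or outside the
    disc; \<open>E\<close> is the half of \<open>N0\<close> on that side.\<close>
  obtain E where E: "connected E" "E \<subseteq> V" "E \<subseteq> G i" "z0 \<in> closure E"
  proof -
    obtain X Y where XY: "crosscut U (\<gamma> i) X Y"
      "\<And>z N. z \<in> \<gamma> i \<Longrightarrow> flat_nbhd (h i) z N \<Longrightarrow> N \<subseteq> U \<Longrightarrow> N - B i \<subseteq> X \<and> N \<inter> I i \<subseteq> Y"
      using chart_crosscut[OF h[OF J(2)] U \<gamma>[OF J(2)]] unfolding B_def I_def by metis
    have N0XY: "N0 - B i \<subseteq> X" "N0 \<inter> I i \<subseteq> Y" using XY(2)[OF z0 N0(1,2)] by simp_all
    have "crosscut U (\<gamma> i) (D i) (G i)" using cutj[OF J(2)] by (simp add: cut_def)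
    then have "G i = X \<or> G i = Y" using crosscut_unique[OF XY(1)] by blast
    then show thesis
    proof
      assume "G i = X"
      then show thesis
        using that[of "N0 - B i"] N0(3) N0XY(1) flat_nbhdD(2,3,6,8)[OF N0(1)] unfolding B_def by blast
    next
      assume "G i = Y"
      then show thesis
        using that[of "N0 \<inter> I i"] N0(4) N0XY(2) flat_nbhdD(2,3,7,9)[OF N0(1)] unfolding I_def by blast
    qed
  qed
  have "E \<noteq> {}" using E(4) by auto
  then have "V \<noteq> {}" using E(2) by blast
  then obtain W where W: "W \<in> components V" "E \<subseteq> W"
    using exists_component_superset[OF E(2) _ E(1)] by blast
  have oW: "sopen W" using sopen_component[OF oV W(1)] .
  have conW: "connected W" and neW: "W \<noteq> {}" and WV: "W \<subseteq> V"
    using in_components_connected[OF W(1)] in_components_nonempty[OF W(1)] in_components_subset[OF W(1)]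
    by simp_all
  have WU: "W \<subseteq> U" and WS: "W \<subseteq> S2" and Wc: "\<And>j. j \<in> J \<Longrightarrow> W \<inter> c j = {}"
    using WV US unfolding V_def by blast+
  have z0W: "z0 \<in> closure W" using closure_mono[OF W(2)] E(4) by blast
  have absorb: "T \<subseteq> W" if "connected T" "T \<subseteq> V" "W \<inter> T \<noteq> {}" for T
    using components_maximal[OF W(1) that] .
  \<comment> \<open>\<open>W\<close> avoids the circle, so it meets one half of \<open>N\<close>;
    that half is connected in \<open>V\<close> and is absorbed by the component
    \<open>W\<close>.\<close>
  have side: "N - B j \<subseteq> W \<or> N \<inter> I j \<subseteq> W"
    if j: "j \<in> J" and N: "flat_nbhd (h j) z N" "N - B j \<subseteq> V" "N \<inter> I j \<subseteq> V"
      and z: "z \<in> closure W" for j z N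
  proof -
    have "N \<inter> W \<noteq> {}" 
      by (rule sopen_closure_meet[OF flat_nbhdD(1)[OF N(1)] WS flat_nbhdD(2)[OF N(1)] z])
    then obtain w where w: "w \<in> N" "w \<in> W" by blast
    have "w \<in> N - B j \<or> w \<in> N \<inter> I j" using w Wc[OF j] BIc(1)[OF j] by blast
    then show ?thesis
    proof
      assume "w \<in> N - B j"
      then have "N - B j \<subseteq> W"
        using absorb[OF _ N(2)] flat_nbhdD(6)[OF N(1)] w B_def by auto
      then show ?thesis ..
    next
      assume "w \<in> N \<inter> I j"
      then have "N \<inter> I j \<subseteq> W"
        using absorb[OF _ N(3)] flat_nbhdD(7)[OF N(1)] w I_def by auto
      then show ?thesis ..
    qed
  qed
  \<comment> \<open>Adherence to \<open>W\<close> is a relatively closed condition on \<delta>, and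
    by \<open>side\<close> also an open one; so it holds everywhere on \<delta> as soon as it holds
    at one point.\<close>
  have adj: "\<delta> \<subseteq> closure W"
    if j: "j \<in> J" and \<delta>: "\<delta> \<in> components (U \<inter> c j)" and z: "z \<in> \<delta>" "z \<in> closure W" for j \<delta> z
  proof -
    have dsub: "\<delta> \<subseteq> U" using in_components_subset[OF \<delta>] by blast
    have "openin (top_of_set \<delta>) (\<delta> \<inter> closure W)"
    proof (subst openin_subopen, intro ballI)
      fix x assume x: "x \<in> \<delta> \<inter> closure W"
      then obtain N where N: "flat_nbhd (h j) x N" "N \<subseteq> U" "N \<inter> c j \<subseteq> \<delta>" "N - B j \<subseteq> V" "N \<inter> I j \<subseteq> V"
        using flat[OF j \<delta>] by blast
      have "N \<inter> c j \<subseteq> closure W"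
        using side[OF j N(1,4,5)] x flat_nbhdD(8,9)[OF N(1)] closure_mono[of "N - B j" W]
          closure_mono[of "N \<inter> I j" W] unfolding B_def c_def I_def by blast
      moreover have "\<delta> \<subseteq> c j" using in_components_subset[OF \<delta>] by blast
      ultimately have "\<delta> \<inter> N \<subseteq> \<delta> \<inter> closure W" by blast
      moreover obtain T where "open T" "N = S2 \<inter> T" using flat_nbhdD(1)[OF N(1)] openin_open by metis
      then have "\<delta> \<inter> N = \<delta> \<inter> T" using dsub US by blast
      then have "openin (top_of_set \<delta>) (\<delta> \<inter> N)" using \<open>open T\<close> by (simp add: openin_open_Int)
      moreover have "x \<in> \<delta> \<inter> N" using x flat_nbhdD(2)[OF N(1)] by blast
      ultimately show "\<exists>T. openin (top_of_set \<delta>) T \<and> x \<in> T \<and> T \<subseteq> \<delta> \<inter> closure W" by blast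
    qed
    moreover have "closedin (top_of_set \<delta>) (\<delta> \<inter> closure W)" by (simp add: closedin_closed_Int)
    ultimately have "\<delta> \<inter> closure W = {} \<or> \<delta> \<inter> closure W = \<delta>"
      using in_components_connected[OF \<delta>] connected_clopen by metis
    then show ?thesis using z by blast
  qed
  \<comment> \<open>Otherwise \<open>\<gamma> k\<close> lies in a component \<open>Q\<close> of
    \<open>U\<close> minus the closure of \<open>W\<close>. Where \<open>Q\<close> touches that
    closure, the crosscut \<delta> separating \<open>W\<close> from \<open>Q\<close> is
    found.\<close>
  have meets: "\<gamma> k \<inter> closure W \<noteq> {}" if k: "k \<in> J" for k
  proof
    assume none: "\<gamma> k \<inter> closure W = {}"
    let ?A = "U \<inter> closure W"
    have ki: "k \<noteq> i" using none z0 z0W by blast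
    have clA: "closedin (top_of_set U) ?A" by (simp add: closedin_closed_Int)
    have neA: "?A \<noteq> {}" using neW WU closure_subset by blast
    have "\<gamma> k \<subseteq> U - ?A" "U - ?A \<noteq> {}" using none \<gamma>sub(1,4)[OF k] by blast+
    then obtain Q where Q: "Q \<in> components (U - ?A)" "\<gamma> k \<subseteq> Q"
      using exists_component_superset[OF _ _ \<gamma>sub(3)[OF k]] by blast
    have Qsub: "Q \<subseteq> U - ?A" and conQ: "connected Q"
      using in_components_subset[OF Q(1)] in_components_connected[OF Q(1)] by simp_all
    have "closure Q \<inter> ?A \<noteq> {}"
      by (rule component_diff_adheres[OF sopen_imp_locally_connected[OF U(1)] U(2) clA neA Q(1)])
    then obtain z where z: "z \<in> closure Q" "z \<in> U" "z \<in> closure W" by blast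
    have QS: "Q \<subseteq> S2" using Qsub US by blast
    have QW: "Q \<inter> W = {}" using Qsub closure_subset by blast
    have "z \<notin> W"
      using sopen_closure_meet[OF oW QS _ z(1)] QW by blast
    \<comment> \<open>A component is relatively closed in \<open>V\<close>, so a point adherent to
      \<open>W\<close> but outside \<open>W\<close> must lie on one of the circles.\<close>
    moreover have "z \<in> W" if "z \<in> V"
    proof -
      obtain T where T: "closed T" "W = V \<inter> T"
        using closedin_component[OF W(1)] closedin_closed by metis
      then have "closure W \<subseteq> T" by (simp add: closure_minimal)
      then show ?thesis using T that z(3) by blast
    qed
    ultimately obtain l where l: "l \<in> J" "z \<in> c l" using z(2) unfolding V_def by blast
    define \<delta> where "\<delta> = connected_component_set (U \<inter> c l) z"
    have zUc: "z \<in> U \<inter> c l" using z(2) l(2) by blast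
    have \<delta>: "\<delta> \<in> components (U \<inter> c l)" "z \<in> \<delta>"
      unfolding \<delta>_def using componentsI[OF zUc] connected_component_refl[OF zUc] by simp_all
    have \<delta>W: "\<delta> \<subseteq> closure W" using adj[OF l(1) \<delta> z(3)] .
    have \<delta>U: "\<delta> \<subseteq> U" "\<delta> \<subseteq> c l" using in_components_subset[OF \<delta>(1)] by auto
    obtain N where N: "flat_nbhd (h l) z N" "N \<subseteq> U" "N \<inter> c l \<subseteq> \<delta>" "N - B l \<subseteq> V" "N \<inter> I l \<subseteq> V"
      using flat[OF l(1) \<delta>] by blast
    obtain X Y where XY: "crosscut U \<delta> X Y"
      "\<And>z N. z \<in> \<delta> \<Longrightarrow> flat_nbhd (h l) z N \<Longrightarrow> N \<subseteq> U \<Longrightarrow> N - B l \<subseteq> X \<and> N \<inter> I l \<subseteq> Y"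
      using chart_crosscut[OF h[OF l(1)] U] \<delta>(1) unfolding B_def I_def c_def by metis
    have NXY: "N - B l \<subseteq> X" "N \<inter> I l \<subseteq> Y" using XY(2)[OF \<delta>(2) N(1,2)] by simp_all
    have Q\<delta>: "Q \<inter> \<delta> = {}" using Qsub \<delta>W by blast
    have W\<delta>: "W \<inter> \<delta> = {}" using \<delta>U(2) Wc[OF l(1)] by blast
    have "N \<inter> Q \<noteq> {}" by (rule sopen_closure_meet[OF flat_nbhdD(1)[OF N(1)] QS flat_nbhdD(2)[OF N(1)] z(1)])
    then obtain q where q: "q \<in> N" "q \<in> Q" by blast
    have "N \<inter> W \<noteq> {}" by (rule sopen_closure_meet[OF flat_nbhdD(1)[OF N(1)] WS flat_nbhdD(2)[OF N(1)] z(3)])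
    then obtain w where w: "w \<in> N" "w \<in> W" by blast
    have qs: "q \<in> N - B l \<or> q \<in> N \<inter> I l" using q Q\<delta> N(3) BIc(1)[OF l(1)] by blast
    have WXY: "W \<subseteq> X \<or> W \<subseteq> Y" using crosscut_other[OF XY(1) conW WU W\<delta>] .
    have QXY: "Q \<subseteq> X \<or> Q \<subseteq> Y" using crosscut_other[OF XY(1) conQ _ Q\<delta>] Qsub by blast
    have XYd: "X \<inter> Y = {}" using crosscutD(8)[OF XY(1)] .
    have neN: "N - B l \<noteq> {}" "N \<inter> I l \<noteq> {}"
      using flat_nbhd_nonempty[OF N(1)] unfolding B_def I_def by simp_all
    \<comment> \<open>\<open>P\<close> is the side of \<delta> containing \<open>W\<close> and
      \<open>R\<close> the side containing \<open>Q\<close>: one half of \<open>N\<close> belongs to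
      \<open>W\<close>, so the disjoint set \<open>Q\<close> enters the other half.\<close>
    obtain P R where PR: "crosscut U \<delta> P R" "W \<subseteq> P" "Q \<subseteq> R"
    proof (cases "N - B l \<subseteq> W")
      case True
      then have "W \<subseteq> X" using WXY NXY(1) neN(1) XYd by blast
      have "q \<in> N \<inter> I l" using qs True QW q(2) by blast
      then have "Q \<subseteq> Y" using QXY NXY(2) XYd q(2) by blast
      then show thesis using that[OF XY(1) \<open>W \<subseteq> X\<close>] by blast
    next
      case False
      then have True: "N \<inter> I l \<subseteq> W" using side[OF l(1) N(1,4,5) z(3)] by blast
      then have "W \<subseteq> Y" using WXY NXY(2) neN(2) XYd by blast
      have "q \<in> N - B l" using qs True QW q(2) by blast
      then have "Q \<subseteq> X" using QXY NXY(1) XYd q(2) by blast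
      then show thesis using that[OF crosscut_sym[OF XY(1)] \<open>W \<subseteq> Y\<close>] by blast
    qed
    have kR: "\<gamma> k \<subseteq> R" using Q(2) PR(3) by blast
    have \<gamma>k\<delta>: "\<gamma> k \<inter> \<delta> = {}" using Q(2) Q\<delta> by blast
    \<comment> \<open>If \<delta> is \<open>\<gamma> i\<close> itself, then \<open>W\<close> is on
      its large side by the choice of \<open>E\<close>, so \<open>\<gamma> k\<close> lies in
      \<open>D i\<close> and \<open>D k\<close> has smaller area than \<open>D i\<close>. Otherwise
      \<delta> has \<open>\<gamma> i\<close> on one side and \<open>\<gamma> k\<close> on the other;
      its small side contains one of them and exceeds \<open>M\<close>.\<close>
    show False
    proof (cases "\<gamma> i = \<delta>")
      case True
      have "crosscut U \<delta> (D i) (G i)" using cutj[OF J(2)] True by (simp add: cut_def)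
      then have "(D i = P \<and> G i = R) \<or> (D i = R \<and> G i = P)" using crosscut_unique[OF PR(1)] by blast
      moreover have "P \<inter> G i \<noteq> {}" using \<open>E \<noteq> {}\<close> E(3) W(2) PR(2) by blast
      ultimately have "D i = R" using crosscutD(8)[OF PR(1)] by blast
      then have "area (D k) < area (D i)"
        using cut_area_less[OF U(1) cutj[OF k] cutj[OF J(2)]] kR \<gamma>k\<delta> True by blast
      then show False using areaj[OF k] areaj[OF J(2)] by simp
    next
      case False
      have i\<delta>: "\<gamma> i \<inter> \<delta> = {}"
      proof (cases "i = l")
        case True
        then show ?thesis
          using components_nonoverlap[OF \<gamma>[OF J(2)]] \<delta>(1) False unfolding c_def by blast
      next
        case False
        then show ?thesis using cdisj[OF J(2) l(1)] \<gamma>sub(2)[OF J(2)] \<delta>U(2) by blast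
      qed
      have iP: "\<gamma> i \<subseteq> P"
      proof -
        have "\<gamma> i \<subseteq> P \<or> \<gamma> i \<subseteq> R" using crosscut_other[OF PR(1) \<gamma>sub(3,1)[OF J(2)] i\<delta>] .
        moreover have "z0 \<notin> R"
          using sopen_closure_meet[OF crosscutD(2)[OF PR(1)] WS _ z0W] PR(2) crosscutD(8)[OF PR(1)] by blast
        ultimately show ?thesis using z0 by blast
      qed
      obtain D' G' where D': "cut U \<delta> D' G'" "area D' \<le> M"
        using M[OF l(1)] \<delta>(1) unfolding c_def by blast
      have "crosscut U \<delta> D' G'" using D'(1) by (simp add: cut_def)
      then have "D' = P \<or> D' = R" using crosscut_unique[OF PR(1)] by blast
      then have "area (D i) < area D' \<or> area (D k) < area D'"
      proof
        assume "D' = P"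
        then show ?thesis using cut_area_less[OF U(1) cutj[OF J(2)] D'(1) i\<delta>] iP by blast
      next
        assume "D' = R"
        then show ?thesis using cut_area_less[OF U(1) cutj[OF k] D'(1) \<gamma>k\<delta>] kR by blast
      qed
      then show False using areaj[OF k] areaj[OF J(2)] D'(2) by linarith
    qed
  qed
  \<comment> \<open>A region inside \<open>B j\<close> would have its closure in \<open>B j\<close>,
    yet that closure reaches a crosscut in a second, disjoint disc. This is where two different
    indices are used.\<close>
  have WB: "W \<inter> B j = {}" if j: "j \<in> J" for j
  proof (rule ccontr)
    assume "W \<inter> B j \<noteq> {}"
    have "sopen (I j)" unfolding I_def using sphere_chart_open[OF h[OF j] open_ball] .
    moreover have "sopen (S2 - B j)" by (rule sopen_compact_diff[OF compB(1)[OF j]]) simp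
    moreover have "I j \<inter> (S2 - B j) = {}" "W \<subseteq> I j \<union> (S2 - B j)"
      using BIc(1)[OF j] Wc[OF j] WS by blast+
    ultimately have "W \<subseteq> I j \<or> W \<subseteq> S2 - B j"
      using connected_sopen_cover[OF conW] by blast
    then have "W \<subseteq> B j" using \<open>W \<inter> B j \<noteq> {}\<close> BIc(1)[OF j] by blast
    then have cW: "closure W \<subseteq> B j" by (rule closure_minimal[OF _ compact_imp_closed[OF compB(1)[OF j]]])
    obtain k where k: "k \<in> J" "k \<noteq> j" using J(2-4) by metis
    have "B k \<inter> B j = {}" using disj[OF k(1) j k(2)] by (simp add: B_def)
    then show False using meets[OF k(1)] cW \<gamma>sub(2)[OF k(1)] cB[of k] by blast
  qed
  show thesis
  proof (rule that[OF oW conW neW WU])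
    show "W \<inter> h j ` cball 0 1 = {}" if "j \<in> J" for j using WB[OF that] by (simp add: B_def)
    show "\<exists>z\<in>\<gamma> j. path_connected (insert z W)" if j: "j \<in> J" for j
    proof -
      obtain z where z: "z \<in> \<gamma> j" "z \<in> closure W" using meets[OF j] by blast
      obtain N where N: "flat_nbhd (h j) z N" "N \<subseteq> U" "N - B j \<subseteq> V" "N \<inter> I j \<subseteq> V"
        using flat[OF j _ z(1)] \<gamma>[OF j] c_def by metis
      have ne: "N - B j \<noteq> {}" "N \<inter> I j \<noteq> {}"
        using flat_nbhd_nonempty[OF N(1)] unfolding B_def I_def by simp_all
      have "\<not> N \<inter> I j \<subseteq> W" using WB[OF j] BIc(1)[OF j] ne(2) by blast
      then have NW: "N - B j \<subseteq> W" using side[OF j N(1,3,4) z(2)] by blast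
      have "path_connected (insert z (N - B j) \<union> W)"
      proof (rule path_connected_Un)
        show "path_connected (insert z (N - B j))" using flat_nbhdD(10)[OF N(1)] by (simp add: B_def)
        show "path_connected W" using sopen_path_connected[OF oW conW] .
        show "insert z (N - B j) \<inter> W \<noteq> {}" using NW ne(1) by blast
      qed
      moreover have "insert z (N - B j) \<union> W = insert z W" using NW by blast
      ultimately show ?thesis using z(1) by auto
    qed
  qed
qed

section \<open>Compact exhaustion and a crosscut of maximal area\<close>

text \<open>Finitely many closed disc images inside \<open>U\<close> cover \<open>K\<close>; paths
  in \<open>U\<close> link them together.\<close>

lemma compact_connected_superset:
  assumes U: "sopen U" "connected U" and K: "compact K" "K \<subseteq> U"
  obtains P where "compact P" "connected P" "K \<subseteq> P" "P \<subseteq> U"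
proof -
  have "\<exists>T N. open T \<and> x \<in> T \<and> S2 \<inter> T \<subseteq> N \<and> compact N \<and> connected N \<and> N \<subseteq> U" if x: "x \<in> K" for x
  proof -
    have xU: "x \<in> U" using x K by blast
    then have xS: "x \<in> S2" using openin_imp_subset[OF U(1)] by blast
    then have mx: "- x \<in> S2" "x \<noteq> - x" using antipode_neq by auto
    then obtain h k where hk: "homeomorphism (UNIV::complex set) (S2 - {- x}) h k"
      using ex_sphere_chart by blast
    then have h: "sphere_chart h" unfolding sphere_chart_def using mx(1) by blast
    have "h ` UNIV = S2 - {- x}" using hk homeomorphism_image1 by blast
    then obtain u where u: "x = h u" using xS mx(2) by blast
    obtain e where e: "e > 0" "cball u e \<subseteq> h -` U"
      using sphere_chart_vimage_open[OF h U(1)] xU u by (metis open_contains_cball vimage_eq)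
    obtain T where T: "open T" "h ` ball u e = S2 \<inter> T"
      using sphere_chart_open[OF h open_ball] openin_open by metis
    have "x \<in> h ` ball u e" using u e(1) by simp
    then have "x \<in> T" using T(2) by blast
    moreover have "S2 \<inter> T \<subseteq> h ` cball u e" unfolding T(2)[symmetric] by (rule image_mono) auto
    moreover have "compact (h ` cball u e)" by (rule chart_compact_image[OF h compact_cball])
    moreover have "connected (h ` cball u e)"
      using sphere_chart_continuous[OF h] by (rule connected_continuous_image) simp
    moreover have "h ` cball u e \<subseteq> U" using e(2) by blast
    ultimately show ?thesis using T(1) by blast
  qed
  then obtain T N where TN: "\<And>x. x \<in> K \<Longrightarrow> open (T x) \<and> x \<in> T x \<and> S2 \<inter> T x \<subseteq> N x \<and>
      compact (N x) \<and> connected (N x) \<and> N x \<subseteq> U"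
    by metis
  obtain F where F: "F \<subseteq> K" "finite F" "K \<subseteq> (\<Union>x\<in>F. T x)"
  proof (rule compactE_image[OF K(1), of K T])
    show "open (T x)" if "x \<in> K" for x using TN[OF that] by simp
    show "K \<subseteq> (\<Union>x\<in>K. T x)" using TN by blast
  qed
  have "\<exists>P. compact P \<and> connected P \<and> (\<Union>x\<in>F. N x) \<subseteq> P \<and> P \<subseteq> U"
    using F(2,1)
  proof (induction F rule: finite_induct)
    case empty
    show ?case by (rule exI[of _ "{}"]) simp
  next
    case (insert x F)
    then obtain P where P: "compact P" "connected P" "(\<Union>x\<in>F. N x) \<subseteq> P" "P \<subseteq> U" by blast
    have N: "compact (N x)" "connected (N x)" "N x \<subseteq> U" "x \<in> N x"
      using TN[of x] insert.prems K(2) openin_imp_subset[OF U(1)] by blast+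
    show ?case
    proof (cases "P = {}")
      case True
      then have "(\<Union>x\<in>insert x F. N x) \<subseteq> N x" using P(3) by blast
      then show ?thesis using N by blast
    next
      case False
      then obtain p where p: "p \<in> P" by blast
      have "path_connected U" using sopen_path_connected[OF U] .
      then obtain r where r: "path r" "path_image r \<subseteq> U" "pathstart r = p" "pathfinish r = x"
        using p P(4) N(3,4) unfolding path_connected_def by (metis subsetD)
      have "connected (P \<union> path_image r)"
        using P(2) connected_path_image[OF r(1)] p r(3) pathstart_in_path_image[of r]
        by (intro connected_Un) auto
      then have "connected ((P \<union> path_image r) \<union> N x)"
        by (rule connected_Un[OF _ N(2)]) (use N(4) r(4) pathfinish_in_path_image[of r] in auto)
      moreover have "compact ((P \<union> path_image r) \<union> N x)"
        using P(1) N(1) compact_path_image[OF r(1)] by (simp add: compact_Un)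
      moreover have "(\<Union>x\<in>insert x F. N x) \<subseteq> (P \<union> path_image r) \<union> N x" using P(3) by blast
      moreover have "(P \<union> path_image r) \<union> N x \<subseteq> U" using P(4) r(2) N(3) by blast
      ultimately show ?thesis by metis
    qed
  qed
  then obtain P where P: "compact P" "connected P" "(\<Union>x\<in>F. N x) \<subseteq> P" "P \<subseteq> U" by blast
  have "K \<subseteq> P"
  proof
    fix x assume x: "x \<in> K"
    then obtain y where y: "y \<in> F" "x \<in> T y" using F(3) by blast
    have "x \<in> S2" using x K(2) openin_imp_subset[OF U(1)] by blast
    then show "x \<in> P" using TN[of y] y F(1) P(3) by blast
  qed
  then show thesis using that P by blast
qed

lemma compact_sets_sphere_area: "compact K \<Longrightarrow> K \<subseteq> S2 \<Longrightarrow> K \<in> sets sphere_area"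
  unfolding sets_sphere_area sets_restrict_space using borel_compact[of K]
  by (intro image_eqI[of K "(\<inter>) S2" K]) auto

text \<open>The areas of a compact exhaustion converge to the area of \<open>U\<close>; a late
  member is then enlarged to a connected compact set.\<close>

lemma ex_large_compact_connected:
  assumes U: "sopen U" "connected U" and t: "t < area U"
  obtains P where "compact P" "connected P" "P \<subseteq> U" "t < area P"
proof -
  interpret finite_measure sphere_area by (rule finite_measure_sphere_area)
  obtain T where T: "open T" "U = S2 \<inter> T" using U(1) openin_open by metis
  obtain C where C: "\<And>n. compact (C n)" "\<And>n. C n \<subseteq> T" "\<And>n. C n \<subseteq> interior (C (Suc n))" "\<Union>(range C) = T"
    using open_Union_compact_subsets[OF T(1)] by metis
  define K where "K n = S2 \<inter> C n" for n
  have K: "compact (K n)" "K n \<subseteq> U" "K n \<subseteq> S2" for n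
    using C(1,2) T(2) unfolding K_def by (auto intro: compact_Int)
  have s: "range K \<subseteq> sets sphere_area" using compact_sets_sphere_area[OF K(1,3)] by blast
  have "incseq K"
    unfolding K_def using C(3) interior_subset by (intro incseq_SucI) blast
  then have "(\<lambda>n. area (K n)) \<longlonglongrightarrow> area (\<Union>(range K))"
    by (rule finite_Lim_measure_incseq[OF s])
  moreover have "\<Union>(range K) = U" unfolding K_def T(2) using C(4) by blast
  ultimately have "\<forall>\<^sub>F n in sequentially. t < area (K n)"
    using t by (simp add: order_tendstoD)
  then obtain n where n: "t < area (K n)"
    using eventually_happens'[OF sequentially_bot] by blast
  obtain P where P: "compact P" "connected P" "K n \<subseteq> P" "P \<subseteq> U"
    using compact_connected_superset[OF U K(1,2)] by metis
  have "P \<in> sets sphere_area"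
    using compact_sets_sphere_area[OF P(1)] P(4) T(2) by blast
  then have "area (K n) \<le> area P" using P(3) finite_measure_mono by blast
  then show thesis using that[OF P(1,2,4)] n by simp
qed

text \<open>A flat neighbourhood meets the circle in a connected set, hence in a single component.
  Finitely many of them cover the compact part of the circle in \<open>P\<close>.\<close>

lemma finite_components_meeting_compact:
  assumes h: "sphere_chart h" and U: "sopen U" and P: "compact P" "P \<subseteq> U"
  shows "finite {c \<in> components (U \<inter> h ` sphere 0 1). c \<inter> P \<noteq> {}}"
proof -
  let ?c = "h ` sphere 0 1"
  have "\<exists>T. open T \<and> flat_nbhd h x (S2 \<inter> T) \<and> S2 \<inter> T \<subseteq> U" if x: "x \<in> P \<inter> ?c" for x
  proof -
    have "x \<in> U" "x \<in> ?c" using x P(2) by blast+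
    then obtain N where N: "flat_nbhd h x N" "N \<subseteq> U" using ex_flat_nbhd[OF h U] by metis
    obtain T where "open T" "N = S2 \<inter> T" using flat_nbhdD(1)[OF N(1)] openin_open by metis
    then show ?thesis using N by metis
  qed
  then obtain T where T: "\<And>x. x \<in> P \<inter> ?c \<Longrightarrow> open (T x) \<and> flat_nbhd h x (S2 \<inter> T x) \<and> S2 \<inter> T x \<subseteq> U"
    by metis
  define N where "N x = S2 \<inter> T x" for x
  have TN: "open (T x) \<and> N x = S2 \<inter> T x \<and> flat_nbhd h x (N x) \<and> N x \<subseteq> U" if "x \<in> P \<inter> ?c" for x
    using T[OF that] by (simp add: N_def)
  have xN: "x \<in> N x" if "x \<in> P \<inter> ?c" for x using TN[OF that] flat_nbhdD(2) by blast
  have comp: "compact (P \<inter> ?c)"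
    using P(1) chart_compact_image[OF h compact_sphere] by (rule compact_Int)
  obtain F where F: "F \<subseteq> P \<inter> ?c" "finite F" "P \<inter> ?c \<subseteq> (\<Union>x\<in>F. T x)"
  proof (rule compactE_image[OF comp, of "P \<inter> ?c" T])
    show "open (T x)" if "x \<in> P \<inter> ?c" for x using TN[OF that] by simp
    show "P \<inter> ?c \<subseteq> (\<Union>x\<in>P \<inter> ?c. T x)" 
    proof
      fix x assume x: "x \<in> P \<inter> ?c"
      then have "x \<in> T x" using xN[OF x] TN[OF x] by simp
      then show "x \<in> (\<Union>x\<in>P \<inter> ?c. T x)" using x by blast
    qed
  qed
  have "{c \<in> components (U \<inter> ?c). c \<inter> P \<noteq> {}} \<subseteq> connected_component_set (U \<inter> ?c) ` F"
  proof
    fix c assume "c \<in> {c \<in> components (U \<inter> ?c). c \<inter> P \<noteq> {}}"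
    then have c: "c \<in> components (U \<inter> ?c)" and "c \<inter> P \<noteq> {}" by simp_all
    then obtain y where y: "y \<in> c" "y \<in> P" by blast
    have yU: "y \<in> U" "y \<in> ?c" using y in_components_subset[OF c] by blast+
    obtain x where x: "x \<in> F" "y \<in> T x" using F(3) y(2) yU(2) by blast
    have xP: "x \<in> P \<inter> ?c" using x(1) F(1) by blast
    have "y \<in> S2" using yU(1) openin_imp_subset[OF U] by blast
    then have "y \<in> N x" using TN[OF xP] x(2) by simp
    moreover have "N x \<inter> ?c \<subseteq> c"
    proof (rule components_maximal[OF c])
      show "connected (N x \<inter> ?c)" using TN[OF xP] flat_nbhdD(5) by blast
      show "N x \<inter> ?c \<subseteq> U \<inter> ?c" using TN[OF xP] by blast
      show "c \<inter> (N x \<inter> ?c) \<noteq> {}" using y(1) yU(2) \<open>y \<in> N x\<close> by blast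
    qed
    ultimately have "x \<in> c" using xN[OF xP] xP by blast
    then have "c = connected_component_set (U \<inter> ?c) x"
      using c by (metis components_iff connected_component_eq)
    then show "c \<in> connected_component_set (U \<inter> ?c) ` F" using x(1) by blast
  qed
  then show ?thesis using F(2) finite_surj by blast
qed

lemma cut_unique:
  assumes "cut U c D G" "cut U c D' G'" "sopen U"
  shows "D' = D" "G' = G"
proof -
  have c: "crosscut U c D G" "crosscut U c D' G'" "area U / 2 < area G'"
    using assms unfolding cut_def by simp_all
  have "area D < area G'" using cut_small[OF assms(1,3)] c(3) by simp
  then show "D' = D" "G' = G" using crosscut_unique[OF c(1,2)] by auto
qed

text \<open>
  The maximum is attained: a compact connected \<open>P\<close> filling up \<open>U\<close> except for area \<open>s\<close> meets every crosscut
  whose small side has area at least \<open>s\<close>, and only finitely many crosscuts meet \<open>P\<close>.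
\<close>

lemma ex_max_cut:
  assumes h: "sphere_chart h" and U: "sopen U" "connected U" and ne: "U \<inter> h ` sphere 0 1 \<noteq> {}"
    and cuts: "\<And>c. c \<in> components (U \<inter> h ` sphere 0 1) \<Longrightarrow> \<exists>D G. cut U c D G"
  obtains c D G where "c \<in> components (U \<inter> h ` sphere 0 1)" "cut U c D G"
    "\<And>c' D' G'. c' \<in> components (U \<inter> h ` sphere 0 1) \<Longrightarrow> cut U c' D' G' \<Longrightarrow> area D' \<le> area D"
proof -
  interpret finite_measure sphere_area by (rule finite_measure_sphere_area)
  let ?K = "components (U \<inter> h ` sphere 0 1)"
  have US: "U \<subseteq> S2" using openin_imp_subset[OF U(1)] .
  obtain D G where DG: "\<And>c. c \<in> ?K \<Longrightarrow> cut U c (D c) (G c)" using cuts by metis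
  obtain c0 where c0: "c0 \<in> ?K" using ne components_eq_empty by blast
  have cc: "crosscut U c (D c) (G c)" if "c \<in> ?K" for c using DG[OF that] by (simp add: cut_def)
  have small: "area (D c) < area U / 2" if "c \<in> ?K" for c using cut_small[OF DG[OF that] U(1)] .
  \<comment> \<open>An arbitrary crosscut \<open>c0\<close> sets the threshold: only those with
    small side at least \<open>s\<close> compete for the maximum.\<close>
  define s where "s = area (D c0)"
  have "D c0 \<noteq> {}" using crosscutD(6,10)[OF cc[OF c0]] by auto
  then have "s > 0" unfolding s_def using area_pos crosscutD(1)[OF cc[OF c0]] by blast
  moreover have "s < area U / 2" unfolding s_def using small[OF c0] .
  ultimately have "area U - s < area U" "area U / 2 < area U - s" by simp_all
  then obtain P where P: "compact P" "connected P" "P \<subseteq> U" "area U - s < area P"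
    using ex_large_compact_connected[OF U] by metis
  have Ps: "P \<in> sets sphere_area" using compact_sets_sphere_area[OF P(1)] P(3) US by blast
  let ?S = "{c \<in> ?K. s \<le> area (D c)}"
  have "?S \<subseteq> {c \<in> ?K. c \<inter> P \<noteq> {}}"
  proof
    fix c assume "c \<in> ?S"
    then have c: "c \<in> ?K" "s \<le> area (D c)" by simp_all
    note ccD = crosscutD[OF cc[OF c(1)]]
    have Ds: "D c \<in> sets sphere_area" using sopen_sets[OF ccD(1)] .
    \<comment> \<open>\<open>P\<close> is too large to miss \<open>D c\<close>, and with more than
      half the area of \<open>U\<close> too large to fit into it; being connected, it must meet
      \<open>c\<close>.\<close>
    have "D c \<inter> P \<noteq> {}"
    proof
      assume "D c \<inter> P = {}"
      then have "area (D c \<union> P) = area (D c) + area P"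
        using finite_measure_Union[OF Ds Ps] by simp
      moreover have "area (D c \<union> P) \<le> area U"
        using ccD(9) P(3) sopen_sets[OF U(1)] by (intro finite_measure_mono) auto
      ultimately show False using P(4) c(2) by simp
    qed
    moreover have "\<not> P \<subseteq> D c"
    proof
      assume "P \<subseteq> D c"
      then have "area P \<le> area (D c)" using Ds finite_measure_mono by blast
      then show False using small[OF c(1)] P(4) \<open>area U / 2 < area U - s\<close> by simp
    qed
    ultimately have "c \<inter> P \<noteq> {}"
      using crosscut_other[OF cc[OF c(1)] P(2,3)] ccD(8) by blast
    then show "c \<in> {c \<in> ?K. c \<inter> P \<noteq> {}}" using c(1) by simp
  qed
  then have fin: "finite ?S"
    using finite_components_meeting_compact[OF h U(1) P(1,3)] by (rule finite_subset)
  have neS: "?S \<noteq> {}" using c0 s_def by blast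
  have "Max ((\<lambda>c. area (D c)) ` ?S) \<in> (\<lambda>c. area (D c)) ` ?S"
    using fin neS by (intro Max_in) auto
  then obtain c where c: "c \<in> ?S" "area (D c) = Max ((\<lambda>c. area (D c)) ` ?S)" by auto
  have max: "area (D c') \<le> area (D c)" if "c' \<in> ?S" for c'
    unfolding c(2) using fin that by (intro Max_ge) auto
  show thesis
  proof (rule that[of c "D c" "G c"])
    show cK: "c \<in> ?K" using c(1) by simp
    show "cut U c (D c) (G c)" using DG[OF cK] .
    fix c' D' G' assume c': "c' \<in> ?K" "cut U c' D' G'"
    have "D' = D c'" using cut_unique(1)[OF DG[OF c'(1)] c'(2) U(1)] .
    moreover have "area (D c') \<le> area (D c)"
    proof (cases "s \<le> area (D c')")
      case True then show ?thesis using max c'(1) by simp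
    next
      case False then show ?thesis using c(1) by simp
    qed
    ultimately show "area D' \<le> area (D c)" by simp
  qed
qed

section \<open>Iterates and the central region of an invariant domain\<close>

lemma homeomorphism_funpow:
  assumes "homeomorphism S S f g"
  shows "homeomorphism S S (f ^^ n) (g ^^ n)"
proof (induction n)
  case 0
  show ?case by (simp add: id_def homeomorphism_ident)
next
  case (Suc n)
  have "homeomorphism S S (f \<circ> f ^^ n) (g ^^ n \<circ> g)"
    using homeomorphism_compose[OF Suc assms] .
  then show ?case by (simp add: funpow_Suc_right del: funpow.simps(2)) (simp add: funpow_swap1 comp_def)
qed

lemma area_preserving_funpow:
  assumes "area_preserving f"
  shows "area_preserving (f ^^ n)"
proof (induction n)
  case 0
  have "A \<inter> S2 = A" if "A \<in> sets sphere_area" for A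
    using sets.sets_into_space[OF that] by (auto simp: space_sphere_area)
  then show ?case by (simp add: area_preserving_def id_def)
next
  case (Suc n)
  have m: "f \<in> measurable sphere_area sphere_area" "f ^^ n \<in> measurable sphere_area sphere_area"
    using assms Suc unfolding area_preserving_def by simp_all
  have "emeasure sphere_area ((f ^^ Suc n) -` A \<inter> S2) = emeasure sphere_area A"
    if A: "A \<in> sets sphere_area" for A
  proof -
    have fA: "f -` A \<inter> S2 \<in> sets sphere_area"
      using measurable_sets[OF m(1) A] by (simp add: space_sphere_area)
    have "(f ^^ Suc n) -` A \<inter> S2 = (f ^^ n) -` (f -` A \<inter> S2) \<inter> S2"
      using measurable_space[OF m(2)] by (auto simp: space_sphere_area)
    then show ?thesis
      using assms Suc A fA unfolding area_preserving_def by metis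
  qed
  moreover have "f ^^ Suc n \<in> measurable sphere_area sphere_area"
    using measurable_comp[OF m(2,1)] by simp
  ultimately show ?case unfolding area_preserving_def by blast
qed

lemma homeomorphism_component:
  assumes hom: "homeomorphism S T f g" and C: "C \<in> components S"
  shows "f ` C \<in> components T"
proof -
  have CS: "C \<subseteq> S" "connected C" "C \<noteq> {}"
    using in_components_subset[OF C] in_components_connected[OF C] in_components_nonempty[OF C] by simp_all
  have "D = f ` C" if D: "D \<noteq> {}" "f ` C \<subseteq> D" "D \<subseteq> T" "connected D" for D
  proof -
    have "connected (g ` D)"
      using D(3,4) homeomorphism_cont2[OF hom] connected_continuous_image continuous_on_subset by metis
    moreover have "g ` D \<subseteq> S" using D(3) homeomorphism_image2[OF hom] by blast
    moreover have "C \<subseteq> g ` D"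
    proof
      fix x assume x: "x \<in> C"
      then have "g (f x) = x" using homeomorphism_apply1[OF hom] CS(1) by blast
      then show "x \<in> g ` D" using x D(2) by (metis image_eqI image_subset_iff)
    qed
    moreover have "\<forall>E. E \<noteq> {} \<and> C \<subseteq> E \<and> E \<subseteq> S \<and> connected E \<longrightarrow> E = C"
      using C unfolding in_components_maximal by (elim conjE)
    then have "g ` D \<noteq> {} \<and> C \<subseteq> g ` D \<and> g ` D \<subseteq> S \<and> connected (g ` D) \<longrightarrow> g ` D = C"
      by (rule spec)
    ultimately have gD: "g ` D = C" using D(1) by simp
    have "D \<subseteq> f ` C"
    proof
      fix y assume y: "y \<in> D"
      then have "f (g y) = y" using homeomorphism_apply2[OF hom] D(3) by blast
      then show "y \<in> f ` C" using y gD by (metis image_eqI)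
    qed
    then show ?thesis using D(2) by blast
  qed
  moreover have "f ` C \<subseteq> T" using CS(1) homeomorphism_image1[OF hom] by blast
  moreover have "connected (f ` C)"
    using CS(1,2) homeomorphism_cont1[OF hom] connected_continuous_image continuous_on_subset by metis
  ultimately show ?thesis
    unfolding in_components_maximal using CS(3) by (intro conjI allI impI) auto
qed

text \<open>Every crosscut on an iterated circle is the image of one on the first circle, with the
  same areas, so a maximal one there stays maximal among all circles when iterated. The indices 0
  and 1 make the disc disjoint from its image, which gives each crosscut a small side.\<close>

lemma ex_invariant_central_region:
  assumes f: "homeomorphism S2 S2 f g" "area_preserving f"
    and U: "sopen U" "connected U" "connected (S2 - U)" "f ` U = U"
    and h: "sphere_chart h" and ne: "U \<inter> h ` sphere 0 1 \<noteq> {}"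
    and J: "finite J" "0 \<in> J" "1 \<in> J"
    and disj: "\<And>j k. j \<in> J \<Longrightarrow> k \<in> J \<Longrightarrow> j \<noteq> k \<Longrightarrow>
      (f ^^ j) ` h ` cball 0 1 \<inter> (f ^^ k) ` h ` cball 0 1 = {}"
  obtains W where "sopen W" "connected W" "W \<noteq> {}" "W \<subseteq> U"
    "\<And>j. j \<in> J \<Longrightarrow> W \<inter> (f ^^ j) ` h ` cball 0 1 = {}"
    "\<And>j. j \<in> J \<Longrightarrow> \<exists>w\<in>sphere 0 1. (f ^^ j) (h w) \<in> U \<and> path_connected (insert ((f ^^ j) (h w)) W)"
proof -
  define H where "H j = (f ^^ j) \<circ> h" for j
  have fj: "homeomorphism S2 S2 (f ^^ j) (g ^^ j)" for j using homeomorphism_funpow[OF f(1)] .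
  have apj: "area_preserving (f ^^ j)" for j using area_preserving_funpow[OF f(2)] .
  have Uj: "(f ^^ j) ` U = U" for j
  proof (induction j)
    case (Suc j)
    have "(f ^^ Suc j) ` U = f ` (f ^^ j) ` U" by (simp add: image_comp)
    then show ?case using Suc U(4) by simp
  qed simp
  have US: "U \<subseteq> S2" using openin_imp_subset[OF U(1)] .
  have Hchart: "sphere_chart (H j)" for j unfolding H_def using sphere_chart_compose[OF h fj] .
  have Himg: "H j ` T = (f ^^ j) ` h ` T" for j T by (simp add: H_def image_comp)
  have homc: "homeomorphism (U \<inter> h ` sphere 0 1) (U \<inter> H j ` sphere 0 1) (f ^^ j) (g ^^ j)" for j
  proof (rule homeomorphism_of_subsets[OF fj, where T'' = "U \<inter> H j ` sphere 0 1"])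
    show "U \<inter> h ` sphere 0 1 \<subseteq> S2" "U \<inter> H j ` sphere 0 1 \<subseteq> S2" using US by blast+
    have "inj_on (f ^^ j) S2"
      by (rule inj_on_inverseI[of _ "g ^^ j"]) (rule homeomorphism_apply1[OF fj])
    then have "(f ^^ j) ` (U \<inter> h ` sphere 0 1) = (f ^^ j) ` U \<inter> (f ^^ j) ` h ` sphere 0 1"
      using US sphere_chart_subset[OF h] by (rule inj_on_image_Int)
    then show "(f ^^ j) ` (U \<inter> h ` sphere 0 1) = U \<inter> H j ` sphere 0 1" by (simp add: Uj Himg)
  qed
  have disjH: "H j ` cball 0 1 \<inter> H k ` cball 0 1 = {}" if "j \<in> J" "k \<in> J" "j \<noteq> k" for j k
    unfolding Himg using disj[OF that] .
  have cuts0: "\<exists>D G. cut U c D G" if c: "c \<in> components (U \<inter> h ` sphere 0 1)" for c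
  proof -
    obtain X Y where XY: "crosscut U c X Y" using chart_crosscut[OF h U(1-3) c] by metis
    have "c \<subseteq> h ` cball 0 1" using in_components_subset[OF c] by auto
    moreover have "h ` cball 0 1 \<inter> f ` h ` cball 0 1 = {}" using disj[OF J(2,3)] by simp
    ultimately have "c \<inter> f ` c = {}" by blast
    then show ?thesis using crosscut_imp_cut[OF f U(4) XY] by blast
  qed
  obtain c D G where c: "c \<in> components (U \<inter> h ` sphere 0 1)" "cut U c D G"
    "\<And>c' D' G'. c' \<in> components (U \<inter> h ` sphere 0 1) \<Longrightarrow> cut U c' D' G' \<Longrightarrow> area D' \<le> area D"
    using ex_max_cut[OF h U(1,2) ne cuts0] by metis
  have areaj: "area ((f ^^ j) ` D') = area D'" if "cut U c' D' G'" for j c' D' G'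
  proof -
    have "crosscut U c' D' G'" using that by (simp add: cut_def)
    then show ?thesis using area_image[OF fj apj crosscutD(1)] by blast
  qed
  obtain W where W: "sopen W" "connected W" "W \<noteq> {}" "W \<subseteq> U" "\<And>j. j \<in> J \<Longrightarrow> W \<inter> H j ` cball 0 1 = {}"
    "\<And>j. j \<in> J \<Longrightarrow> \<exists>z\<in>(f ^^ j) ` c. path_connected (insert z W)"
  proof (rule ex_central_region[of J H 0 1 U "area D" "\<lambda>j. (f ^^ j) ` c" "\<lambda>j. (f ^^ j) ` D" "\<lambda>j. (f ^^ j) ` G"])
    show "\<exists>D' G'. cut U c' D' G' \<and> area D' \<le> area D"
      if c': "c' \<in> components (U \<inter> H k ` sphere 0 1)" for k c'
    proof -
      let ?c = "(g ^^ k) ` c'"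
      have "?c \<in> components (U \<inter> h ` sphere 0 1)"
        using homeomorphism_component[OF homeomorphism_symD[OF homc] c'] .
      moreover from this obtain D' G' where cut': "cut U ?c D' G'" using cuts0 by metis
      ultimately have "area D' \<le> area D" using c(3) by blast
      have "(f ^^ k) ` ?c = c'"
      proof -
        have "c' \<subseteq> S2" using in_components_subset[OF c'] US by blast
        then have "(f ^^ k) ((g ^^ k) x) = x" if "x \<in> c'" for x
          using homeomorphism_apply2[OF fj] that by blast
        then show ?thesis unfolding image_image by simp
      qed
      then have "cut U c' ((f ^^ k) ` D') ((f ^^ k) ` G')"
        using cut_image[OF fj apj Uj cut'] by metis
      then show ?thesis using areaj[OF cut'] \<open>area D' \<le> area D\<close> by metis
    qed
    show "(f ^^ j) ` c \<in> components (U \<inter> H j ` sphere 0 1)" for j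
      using homeomorphism_component[OF homc c(1)] .
    show "cut U ((f ^^ j) ` c) ((f ^^ j) ` D) ((f ^^ j) ` G)" for j
      using cut_image[OF fj apj Uj c(2)] .
    show "area ((f ^^ j) ` D) = area D" for j using areaj[OF c(2)] .
  qed (use Hchart disjH J U in \<open>simp_all\<close>)
  show thesis
  proof (rule that[OF W(1-4)])
    show "W \<inter> (f ^^ j) ` h ` cball 0 1 = {}" if "j \<in> J" for j using W(5)[OF that] by (simp add: Himg)
    show "\<exists>w\<in>sphere 0 1. (f ^^ j) (h w) \<in> U \<and> path_connected (insert ((f ^^ j) (h w)) W)"
      if j: "j \<in> J" for j
    proof -
      obtain y where y: "y \<in> c" "path_connected (insert ((f ^^ j) y) W)" using W(6)[OF j] by blast
      then obtain w where w: "w \<in> sphere 0 1" "y = h w" "y \<in> U"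
        using in_components_subset[OF c(1)] by blast
      then have "(f ^^ j) y \<in> U" using Uj by blast
      then show ?thesis using w y(2) by blast
    qed
  qed
qed

text \<open>A chart omitting a point \<open>q\<close> off the whole configuration reduces this to
  the plane. A suitable \<open>q\<close> depends on the drawing and is supplied with it.\<close>

lemma sphere_theta_no_centre:
  fixes a b c :: "real^3"
  assumes arcs: "arc g1" "arc g2" "arc g3"
    and ends: "pathstart g1 = a" "pathstart g2 = a" "pathstart g3 = a"
      "pathfinish g1 = b" "pathfinish g2 = b" "pathfinish g3 = b"
    and meet: "path_image g1 \<inter> path_image g2 = {a, b}"
      "path_image g1 \<inter> path_image g3 = {a, b}" "path_image g2 \<inter> path_image g3 = {a, b}"
    and Y: "connected Y1" "connected Y2" "connected Y3" "c \<in> Y1" "c \<in> Y2" "c \<in> Y3"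
    and sub: "path_image g1 - {a, b} \<subseteq> Y1" "path_image g2 - {a, b} \<subseteq> Y2"
      "path_image g3 - {a, b} \<subseteq> Y3"
    and disj: "Y1 \<inter> (path_image g2 \<union> path_image g3) = {}"
      "Y2 \<inter> (path_image g1 \<union> path_image g3) = {}"
      "Y3 \<inter> (path_image g1 \<union> path_image g2) = {}"
    and q: "q \<in> S2" "{a, b} \<subseteq> S2 - {q}" "Y1 \<subseteq> S2 - {q}" "Y2 \<subseteq> S2 - {q}" "Y3 \<subseteq> S2 - {q}"
  shows False
proof -
  obtain h k where hk: "homeomorphism (UNIV::complex set) (S2 - {q}) h k"
    using ex_sphere_chart[OF q(1)] .
  have cont: "continuous_on T k" if "T \<subseteq> S2 - {q}" for T
    using homeomorphism_cont2[OF hk] continuous_on_subset that by blast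
  have inj: "inj_on k (S2 - {q})"
    using homeomorphism_apply2[OF hk] by (metis inj_on_inverseI)
  have A: "path_image g1 \<subseteq> S2 - {q}" "path_image g2 \<subseteq> S2 - {q}" "path_image g3 \<subseteq> S2 - {q}"
    using sub q by blast+
  have arck: "arc (k \<circ> g)" if "arc g" "path_image g \<subseteq> S2 - {q}" for g
  proof -
    have "inj_on (k \<circ> g) {0..1}"
      using that inj unfolding arc_def path_image_def by (metis comp_inj_on inj_on_subset)
    then show ?thesis
      using that cont[OF that(2)] path_continuous_image unfolding arc_def by blast
  qed
  have im: "k ` S \<inter> k ` T = k ` (S \<inter> T)" if "S \<subseteq> S2 - {q}" "T \<subseteq> S2 - {q}" for S T
    using inj_on_image_Int[OF inj that] by simp
  have con: "connected (k ` T)" if "connected T" "T \<subseteq> S2 - {q}" for T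
    using connected_continuous_image[OF cont[OF that(2)] that(1)] .
  have minus: "k ` S - {k a, k b} \<subseteq> k ` T" if "S - {a, b} \<subseteq> T" for S T
    using that by blast
  show False
  proof (rule theta_no_centre[of "k \<circ> g1" "k \<circ> g2" "k \<circ> g3" "k a" "k b" "k ` Y1" "k ` Y2" "k ` Y3" "k c"])
    show "arc (k \<circ> g1)" "arc (k \<circ> g2)" "arc (k \<circ> g3)" using arck arcs A by blast+
    show "pathstart (k \<circ> g1) = k a" "pathstart (k \<circ> g2) = k a" "pathstart (k \<circ> g3) = k a"
      "pathfinish (k \<circ> g1) = k b" "pathfinish (k \<circ> g2) = k b" "pathfinish (k \<circ> g3) = k b"
      using ends by (simp_all add: pathstart_compose pathfinish_compose)
    show "path_image (k \<circ> g1) \<inter> path_image (k \<circ> g2) = {k a, k b}"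
      "path_image (k \<circ> g1) \<inter> path_image (k \<circ> g3) = {k a, k b}"
      "path_image (k \<circ> g2) \<inter> path_image (k \<circ> g3) = {k a, k b}"
      unfolding path_image_compose im[OF A(1,2)] im[OF A(1,3)] im[OF A(2,3)] meet by simp_all
    show "connected (k ` Y1)" "connected (k ` Y2)" "connected (k ` Y3)" using con Y(1-3) q(3-5) by blast+
    show "k c \<in> k ` Y1" "k c \<in> k ` Y2" "k c \<in> k ` Y3" using Y(4-6) by blast+
    show "path_image (k \<circ> g1) - {k a, k b} \<subseteq> k ` Y1" "path_image (k \<circ> g2) - {k a, k b} \<subseteq> k ` Y2"
      "path_image (k \<circ> g3) - {k a, k b} \<subseteq> k ` Y3"
      unfolding path_image_compose using minus sub by blast+
    show "k ` Y1 \<inter> (path_image (k \<circ> g2) \<union> path_image (k \<circ> g3)) = {}"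
      "k ` Y2 \<inter> (path_image (k \<circ> g1) \<union> path_image (k \<circ> g3)) = {}"
      "k ` Y3 \<inter> (path_image (k \<circ> g1) \<union> path_image (k \<circ> g2)) = {}"
      unfolding path_image_compose image_Un[symmetric]
      using im[OF q(3) Un_least[OF A(2,3)]] im[OF q(4) Un_least[OF A(1,3)]] im[OF q(5) Un_least[OF A(1,2)]] disj
      by simp_all
  qed
qed

section \<open>Three invariant domains\<close>

lemma ex_small_chart:
  assumes "sopen O'" "x \<in> O'"
  obtains h where "sphere_chart h" "h 0 = x" "h ` cball 0 1 \<subseteq> O'"
proof -
  have xS: "x \<in> S2" using openin_imp_subset[OF assms(1)] assms(2) by blast
  then have mx: "- x \<in> S2" "x \<noteq> - x" using antipode_neq by auto
  then obtain h k where hk: "homeomorphism (UNIV::complex set) (S2 - {- x}) h k"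
    using ex_sphere_chart by blast
  then have h: "sphere_chart h" unfolding sphere_chart_def using mx(1) by blast
  have "h ` UNIV = S2 - {- x}" using hk homeomorphism_image1 by blast
  then obtain u where u: "x = h u" using xS mx(2) by blast
  obtain r where r: "r > 0" "cball u r \<subseteq> h -` O'"
    using sphere_chart_vimage_open[OF h assms(1)] assms(2) u by (metis open_contains_cball vimage_eq)
  define a where "a z = u + of_real r * z" for z :: complex
  have "homeomorphism UNIV UNIV a (\<lambda>z. (z - u) / of_real r)"
  proof (rule homeomorphismI)
    show "continuous_on UNIV a" "continuous_on UNIV (\<lambda>z. (z - u) / of_real r)"
      unfolding a_def using r(1) by (intro continuous_intros; simp)+
  qed (use r(1) in \<open>auto simp: a_def\<close>)
  then have "homeomorphism UNIV (S2 - {- x}) (h \<circ> a) ((\<lambda>z. (z - u) / of_real r) \<circ> k)"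
    using hk homeomorphism_compose by metis
  then have "sphere_chart (h \<circ> a)" unfolding sphere_chart_def using mx(1) by blast
  moreover have "(h \<circ> a) 0 = x" using u by (simp add: a_def)
  moreover have "(h \<circ> a) ` cball 0 1 \<subseteq> O'"
  proof -
    have "a z \<in> cball u r" if "z \<in> cball 0 1" for z
      using that r(1) by (simp add: a_def dist_norm norm_mult mult_left_le)
    then have "a ` cball 0 1 \<subseteq> h -` O'" using r(2) by blast
    then show ?thesis unfolding image_comp[symmetric] by blast
  qed
  ultimately show thesis by (rule that)
qed

section \<open>Drawing the graph around three points of an orbit\<close>

lemma ex_disjoint_images_nbhd:
  assumes f: "homeomorphism S2 S2 f g" and x: "x \<in> S2" and J: "finite J"
    and ne: "\<And>j k. j \<in> J \<Longrightarrow> k \<in> J \<Longrightarrow> j \<noteq> k \<Longrightarrow> (f ^^ j) x \<noteq> (f ^^ k) x"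
  obtains O' where "sopen O'" "x \<in> O'"
    "\<And>j k. j \<in> J \<Longrightarrow> k \<in> J \<Longrightarrow> j \<noteq> k \<Longrightarrow> (f ^^ j) ` O' \<inter> (f ^^ k) ` O' = {}"
proof -
  let ?F = "(\<lambda>j. (f ^^ j) x) ` J"
  obtain d where d: "d > 0" "\<And>p q. p \<in> ?F \<Longrightarrow> q \<in> ?F \<Longrightarrow> p \<noteq> q \<Longrightarrow> d \<le> dist p q"
  proof -
    have "\<exists>d>0. \<forall>q\<in>?F. q \<noteq> p \<longrightarrow> d \<le> dist p q" for p
      using J finite_set_avoid by blast
    then obtain e where e: "\<And>p. e p > 0" "\<And>p q. q \<in> ?F \<Longrightarrow> q \<noteq> p \<Longrightarrow> e p \<le> dist p q" by metis
    \<comment> \<open>The inserted 1 is a default that keeps the minimum meaningful for empty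
      \<open>J\<close>.\<close>
    define d where "d = Min (insert 1 (e ` ?F))"
    have fin: "finite (insert 1 (e ` ?F))" using J by simp
    have "d > 0" unfolding d_def using fin e(1) by (subst Min_gr_iff) auto
    moreover have "d \<le> dist p q" if "p \<in> ?F" "q \<in> ?F" "p \<noteq> q" for p q
    proof -
      have "d \<le> e p" unfolding d_def using fin that(1) by (intro Min_le) auto
      then show ?thesis using e(2)[OF that(2), of p] that(3) by simp
    qed
    ultimately show thesis by (rule that)
  qed
  define O' where "O' = S2 \<inter> (\<Inter>j\<in>J. S2 \<inter> (f ^^ j) -` ball ((f ^^ j) x) (d / 2))"
  have "sopen O'"
    unfolding O'_def
  proof (cases "J = {}")
    case False
    have "sopen (S2 \<inter> (f ^^ j) -` ball ((f ^^ j) x) (d / 2))" for j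
      by (rule continuous_openin_preimage_gen[OF homeomorphism_cont1[OF homeomorphism_funpow[OF f]] open_ball])
    then have "sopen (\<Inter>j\<in>J. S2 \<inter> (f ^^ j) -` ball ((f ^^ j) x) (d / 2))"
      using J False by (intro openin_Inter) auto
    then show "sopen (S2 \<inter> (\<Inter>j\<in>J. S2 \<inter> (f ^^ j) -` ball ((f ^^ j) x) (d / 2)))"
      by (intro openin_Int openin_subtopology_self)
  qed simp
  moreover have "x \<in> O'" using x d(1) by (simp add: O'_def)
  moreover have "(f ^^ j) ` O' \<inter> (f ^^ k) ` O' = {}" if jk: "j \<in> J" "k \<in> J" "j \<noteq> k" for j k
  proof (rule ccontr)
    assume "\<not> ?thesis"
    moreover have "(f ^^ i) ` O' \<subseteq> ball ((f ^^ i) x) (d / 2)" if "i \<in> J" for i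
      using that unfolding O'_def by blast
    ultimately obtain y where y: "y \<in> ball ((f ^^ j) x) (d / 2)" "y \<in> ball ((f ^^ k) x) (d / 2)"
      using jk(1,2) by blast
    then have "dist ((f ^^ j) x) ((f ^^ k) x) < d"
      using dist_triangle_half_r[of y "(f ^^ j) x" d "(f ^^ k) x"] by (simp add: dist_commute)
    then show False using d(2)[of "(f ^^ j) x" "(f ^^ k) x"] jk ne[OF jk] by simp
  qed
  ultimately show thesis by (rule that)
qed

text \<open>The four fourth roots of unity cannot all be among three values. This places the
  puncture of the sphere on a circle, away from three radii.\<close>

lemma ex_unit_complex_avoiding:
  fixes w :: "'i \<Rightarrow> complex"
  assumes "finite A" "card A \<le> 3"
  obtains u where "norm u = 1" "u \<notin> w ` A"
proof -
  let ?R = "{1, -1, \<i>, -\<i>}"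
  have "card ?R = 4" by (simp add: complex_eq_iff)
  moreover have "card (w ` A) \<le> 3" using card_image_le[OF assms(1), of w] assms(2) by simp
  ultimately have "\<not> ?R \<subseteq> w ` A" using card_mono[of "w ` A" ?R] assms(1) by auto
  then obtain u where "u \<in> ?R" "u \<notin> w ` A" by blast
  moreover from this have "norm u = 1" by auto
  ultimately show thesis using that by blast
qed

text \<open>One vertex class of the graph consists of the disc centres \<open>a\<close>,
  \<open>b\<close>, \<open>c\<close>, the other of the regions \<open>W i\<close>; an edge is a
  radius whose outer end is accessible from the region.\<close>

lemma no_disjoint_triple_images:
  fixes U :: "nat \<Rightarrow> (real^3) set"
  assumes f: "homeomorphism S2 S2 f g" "area_preserving f"
    and U: "\<And>i. i \<in> {0, 1, 2} \<Longrightarrow> sopen (U i) \<and> connected (U i) \<and> connected (S2 - U i) \<and> f ` U i = U i \<and> x \<in> closure (U i)"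
    and dU: "\<And>i k. i \<in> {0, 1, 2} \<Longrightarrow> k \<in> {0, 1, 2} \<Longrightarrow> i \<noteq> k \<Longrightarrow> U i \<inter> U k = {}"
    and x: "x \<in> S2" "x \<noteq> f x" "x \<noteq> (f ^^ 2) x"
  shows False
proof -
  let ?J = "{0, 1, 2::nat}"
  have inj: "inj_on (f ^^ j) S2" for j
    by (rule inj_on_inverseI[of _ "g ^^ j"]) (rule homeomorphism_apply1[OF homeomorphism_funpow[OF f(1)]])
  have fS: "f x \<in> S2" using homeomorphism_image1[OF f(1)] x(1) by blast
  have x12: "f x \<noteq> (f ^^ 2) x"
  proof
    assume "f x = (f ^^ 2) x"
    then have "f x = f (f x)" by (simp add: numeral_2_eq_2)
    then have "x = f x" using inj_onD[OF inj[of 1], of x "f x"] x(1) fS by simp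
    then show False using x(2) by simp
  qed
  have "(f ^^ j) x \<noteq> (f ^^ k) x" if "j \<in> ?J" "k \<in> ?J" "j \<noteq> k" for j k
    using that x(2,3) x12 x(2,3)[symmetric] x12[symmetric] by (elim insertE emptyE) simp_all
  note distinct = this
  obtain O' where O': "sopen O'" "x \<in> O'"
    "\<And>j k. j \<in> ?J \<Longrightarrow> k \<in> ?J \<Longrightarrow> j \<noteq> k \<Longrightarrow> (f ^^ j) ` O' \<inter> (f ^^ k) ` O' = {}"
    by (rule ex_disjoint_images_nbhd[OF f(1) x(1), of ?J]) (use distinct in blast)+
  obtain h where h: "sphere_chart h" "h 0 = x" "h ` cball 0 1 \<subseteq> O'"
    using ex_small_chart[OF O'(1,2)] .
  have disj: "(f ^^ j) ` h ` cball 0 1 \<inter> (f ^^ k) ` h ` cball 0 1 = {}"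
    if "j \<in> ?J" "k \<in> ?J" "j \<noteq> k" for j k
    using O'(3)[OF that] h(3) by blast
  define H where "H j = (f ^^ j) \<circ> h" for j
  have Hchart: "sphere_chart (H j)" for j
    unfolding H_def using sphere_chart_compose[OF h(1) homeomorphism_funpow[OF f(1)]] .
  have Hinj: "inj (H j)" and Hcont: "continuous_on T (H j)" and HS: "H j ` T \<subseteq> S2" for j T
    using sphere_chart_inj[OF Hchart] sphere_chart_continuous[OF Hchart] sphere_chart_subset[OF Hchart]
    by simp_all
  have Himg: "H j ` T = (f ^^ j) ` h ` T" for j T by (simp add: H_def image_comp)
  define B where "B j = H j ` cball 0 1" for j
  have disjB: "B j \<inter> B k = {}" if "j \<in> ?J" "k \<in> ?J" "j \<noteq> k" for j k
    unfolding B_def Himg using disj[OF that] .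
  \<comment> \<open>\<open>U i\<close> enters the open disc because \<open>x\<close> is adherent to
    it. Missing the circle, it would lie in the disc and, by invariance, also in the disjoint image
    of the disc.\<close>
  have meets: "U i \<inter> h ` sphere 0 1 \<noteq> {}" if i: "i \<in> ?J" for i
  proof
    assume none: "U i \<inter> h ` sphere 0 1 = {}"
    note split = chart_disc_split[OF h(1)]
    have Ui: "sopen (U i)" "connected (U i)" "f ` U i = U i" "x \<in> closure (U i)" using U[OF i] by simp_all
    have US: "U i \<subseteq> S2" using openin_imp_subset[OF Ui(1)] .
    have oI: "sopen (h ` ball 0 1)" using sphere_chart_open[OF h(1) open_ball] .
    have "x \<in> h ` ball 0 1" using h(2) by force
    then have m: "h ` ball 0 1 \<inter> U i \<noteq> {}" using sopen_closure_meet[OF oI US _ Ui(4)] by blast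
    have "sopen (S2 - h ` cball 0 1)"
      by (rule sopen_compact_diff[OF chart_compact_image[OF h(1) compact_cball]]) simp
    moreover have "h ` ball 0 1 \<inter> (S2 - h ` cball 0 1) = {}" "U i \<subseteq> h ` ball 0 1 \<union> (S2 - h ` cball 0 1)"
      using split(1) none US by blast+
    ultimately have "U i \<subseteq> h ` ball 0 1 \<or> U i \<subseteq> S2 - h ` cball 0 1"
      using connected_sopen_cover[OF Ui(2) oI] by blast
    then have sub: "U i \<subseteq> h ` cball 0 1" using m split(1) by blast
    then have "U i \<subseteq> f ` h ` cball 0 1" using Ui(3) by blast
    moreover have "h ` cball 0 1 \<inter> f ` h ` cball 0 1 = {}" using disj[of 0 1] by simp
    ultimately have "U i = {}" using sub by blast
    then show False using m by blast
  qed
  have "\<exists>W. sopen W \<and> connected W \<and> W \<noteq> {} \<and> W \<subseteq> U i \<and> (\<forall>j\<in>?J. W \<inter> B j = {}) \<and>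
      (\<forall>j\<in>?J. \<exists>w\<in>sphere 0 1. H j w \<in> U i \<and> path_connected (insert (H j w) W))" if i: "i \<in> ?J" for i
  proof -
    have Ui: "sopen (U i)" "connected (U i)" "connected (S2 - U i)" "f ` U i = U i" using U[OF i] by simp_all
    obtain W where W: "sopen W" "connected W" "W \<noteq> {}" "W \<subseteq> U i"
      "\<And>j. j \<in> ?J \<Longrightarrow> W \<inter> (f ^^ j) ` h ` cball 0 1 = {}"
      "\<And>j. j \<in> ?J \<Longrightarrow> \<exists>w\<in>sphere 0 1. (f ^^ j) (h w) \<in> U i \<and> path_connected (insert ((f ^^ j) (h w)) W)"
      by (rule ex_invariant_central_region[OF f Ui h(1) meets[OF i], of ?J]) (use disj in auto)
    have "\<forall>j\<in>?J. W \<inter> B j = {}" unfolding B_def Himg by (intro ballI W(5))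
    moreover have "\<forall>j\<in>?J. \<exists>w\<in>sphere 0 1. H j w \<in> U i \<and> path_connected (insert (H j w) W)"
      unfolding H_def comp_apply by (intro ballI W(6))
    ultimately show ?thesis using W(1-4) by (intro exI[of _ W] conjI)
  qed
  then obtain W where W: "\<And>i. i \<in> ?J \<Longrightarrow> sopen (W i) \<and> connected (W i) \<and> W i \<noteq> {} \<and> W i \<subseteq> U i \<and> (\<forall>j\<in>?J. W i \<inter> B j = {}) \<and>
      (\<forall>j\<in>?J. \<exists>w\<in>sphere 0 1. H j w \<in> U i \<and> path_connected (insert (H j w) (W i)))"
    by metis
  then have "\<forall>i\<in>?J. \<forall>j\<in>?J. \<exists>w\<in>sphere 0 1. H j w \<in> U i \<and> path_connected (insert (H j w) (W i))"
    by blast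
  then obtain w where w: "\<And>i j. i \<in> ?J \<Longrightarrow> j \<in> ?J \<Longrightarrow>
      norm (w i j) = 1 \<and> H j (w i j) \<in> U i \<and> path_connected (insert (H j (w i j)) (W i))"
    unfolding Bex_def mem_sphere_0 by metis
  \<comment> \<open>\<open>R i j\<close> is the radius from the centre of disc \<open>j\<close> to
    the point where \<open>W i\<close> touches its circle; \<open>R'\<close> omits the
    centre.\<close>
  define R where "R i j = H j ` (\<lambda>t. of_real t * w i j) ` {0..1::real}" for i j
  define R' where "R' i j = H j ` (\<lambda>t. of_real t * w i j) ` {0<..1::real}" for i j
  \<comment> \<open>\<open>M i\<close> carries the arc of the theta curve from \<open>a\<close> to
    \<open>b\<close>; \<open>Y i\<close> drops both end points and gains the arm to the third
    centre.\<close>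
  define M where "M i = (R i 0 \<union> W i) \<union> R i 1" for i
  define Y where "Y i = ((R' i 0 \<union> W i) \<union> R' i 1) \<union> R i 2" for i
  have Rins: "R i j = insert (H j 0) (R' i j)" for i j
  proof -
    have "{0..1::real} = insert 0 {0<..1}" by auto
    then show ?thesis unfolding R_def R'_def by simp
  qed
  have Rconn: "path_connected (R i j)" and R'conn: "path_connected (R' i j)" for i j
  proof -
    have "path_connected (H j ` (\<lambda>t. of_real t * w i j) ` T)" if "path_connected T" for T :: "real set"
      using that by (intro path_connected_continuous_image Hcont continuous_intros)
    then show "path_connected (R i j)" "path_connected (R' i j)"
      unfolding R_def R'_def by (simp_all add: convex_imp_path_connected)
  qed
  have RB: "R i j \<subseteq> B j" if "i \<in> ?J" "j \<in> ?J" for i j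
    unfolding R_def B_def using w[OF that] by (intro image_mono image_subsetI) (simp add: norm_mult)
  have zR': "H j (w i j) \<in> R' i j" for i j
    unfolding R'_def by (rule imageI, rule image_eqI[of _ _ 1]) auto
  have R'R: "R' i j \<subseteq> R i j" for i j using Rins by blast
  have R'W: "path_connected (R' i j \<union> W i)" and RW: "path_connected (R i j \<union> W i)"
    if ij: "i \<in> ?J" "j \<in> ?J" for i j
  proof -
    have pc: "path_connected (insert (H j (w i j)) (W i))" using w[OF ij] by simp
    have "path_connected (R' i j \<union> insert (H j (w i j)) (W i))"
      using zR' by (intro path_connected_Un R'conn pc) blast
    moreover have "R' i j \<union> insert (H j (w i j)) (W i) = R' i j \<union> W i" using zR' by blast
    ultimately show "path_connected (R' i j \<union> W i)" by simp
    have "path_connected (R i j \<union> insert (H j (w i j)) (W i))"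
      using zR' R'R by (intro path_connected_Un Rconn pc) blast
    moreover have "R i j \<union> insert (H j (w i j)) (W i) = R i j \<union> W i" using zR' R'R by blast
    ultimately show "path_connected (R i j \<union> W i)" by simp
  qed
  have Wne: "W i \<noteq> {}" if "i \<in> ?J" for i
    using W[OF that] by simp
  have Mconn: "path_connected (M i)" if i: "i \<in> ?J" for i
  proof -
    have "path_connected ((R i 0 \<union> W i) \<union> (R i 1 \<union> W i))"
      using Wne[OF i] by (intro path_connected_Un RW i) auto
    moreover have "(R i 0 \<union> W i) \<union> (R i 1 \<union> W i) = M i" unfolding M_def by blast
    ultimately show ?thesis by simp
  qed
  have Yconn: "connected (Y i)" if i: "i \<in> ?J" for i
  proof -
    have "path_connected (((R' i 0 \<union> W i) \<union> (R' i 1 \<union> W i)) \<union> (R i 2 \<union> W i))"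
      using Wne[OF i] by (intro path_connected_Un RW R'W i) auto
    moreover have "((R' i 0 \<union> W i) \<union> (R' i 1 \<union> W i)) \<union> (R i 2 \<union> W i) = Y i" unfolding Y_def by blast
    ultimately show ?thesis using path_connected_imp_connected by metis
  qed
  define a where "a = H 0 0"
  define b where "b = H 1 0"
  define c where "c = H 2 0"
  have ab: "a \<noteq> b"
    using disjB[of 0 1] unfolding a_def b_def B_def by force
  have MY: "M i - {a, b} \<subseteq> Y i" for i
    unfolding M_def Y_def Rins a_def b_def by blast
  have aM: "a \<in> M i" "b \<in> M i" "c \<in> Y i" for i
    unfolding M_def Y_def Rins a_def b_def c_def by blast+
  \<comment> \<open>Radii of one disc that share a point off the centre coincide, but their outer
    ends lie in the disjoint sets \<open>U i\<close> and \<open>U k\<close>.\<close>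
  have R'R0: "R' i j \<inter> R k j = {}" if ik: "i \<in> ?J" "k \<in> ?J" "j \<in> ?J" "i \<noteq> k" for i j k
  proof (rule ccontr)
    assume "R' i j \<inter> R k j \<noteq> {}"
    then obtain t s where ts: "0 < t" "0 \<le> s" "H j (of_real t * w i j) = H j (of_real s * w k j)"
      unfolding R_def R'_def by auto
    then have eq: "of_real t * w i j = of_real s * w k j" using injD[OF Hinj] by blast
    then have "norm (of_real t * w i j) = norm (of_real s * w k j)" by simp
    then have "t = s" using ts(1,2) w[OF ik(1,3)] w[OF ik(2,3)] by (simp add: norm_mult)
    then have "w i j = w k j" using eq ts(1) by simp
    then have "H j (w i j) \<in> U i \<inter> U k" using w[OF ik(1,3)] w[OF ik(2,3)] by simp
    then show False using dU[OF ik(1,2,4)] by blast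
  qed
  have RR: "R i j \<inter> R k l = {}" if "i \<in> ?J" "k \<in> ?J" "j \<in> ?J" "l \<in> ?J" "j \<noteq> l" for i j k l
    using RB[of i j] RB[of k l] disjB[of j l] that by blast
  have WR: "W i \<inter> R k j = {}" if "i \<in> ?J" "k \<in> ?J" "j \<in> ?J" for i j k
    using RB[OF that(2,3)] W[OF that(1)] that(3) by blast
  have WW: "W i \<inter> W k = {}" if "i \<in> ?J" "k \<in> ?J" "i \<noteq> k" for i k
    using dU[OF that] W[OF that(1)] W[OF that(2)] by blast
  have J: "(0::nat) \<in> ?J" "1 \<in> ?J" "2 \<in> ?J" "(0::nat) \<noteq> 1" "(0::nat) \<noteq> 2" "(1::nat) \<noteq> 2" by simp_all
  have YM: "Y i \<inter> M k = {}" if ik: "i \<in> ?J" "k \<in> ?J" "i \<noteq> k" for i k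
  proof -
    have 1: "R' i 0 \<inter> R k 0 = {}" "R' i 1 \<inter> R k 1 = {}"
      using R'R0[OF ik(1,2) J(1) ik(3)] R'R0[OF ik(1,2) J(2) ik(3)] .
    have 2: "R' i 0 \<inter> R k 1 = {}" "R' i 1 \<inter> R k 0 = {}"
      using RR[OF ik(1,2) J(1,2,4)] RR[OF ik(1,2) J(2,1) not_sym[OF J(4)]] R'R[of i 0] R'R[of i 1]
      by blast+
    have 3: "R i 2 \<inter> R k 0 = {}" "R i 2 \<inter> R k 1 = {}"
      using RR[OF ik(1,2) J(3,1)] RR[OF ik(1,2) J(3,2)] by simp_all
    have 4: "W i \<inter> R k 0 = {}" "W i \<inter> R k 1 = {}" "W i \<inter> W k = {}"
      using WR[OF ik(1,2) J(1)] WR[OF ik(1,2) J(2)] WW[OF ik] .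
    have 5: "R' i 0 \<inter> W k = {}" "R' i 1 \<inter> W k = {}" "R i 2 \<inter> W k = {}"
      using WR[OF ik(2,1) J(1)] WR[OF ik(2,1) J(2)] WR[OF ik(2,1) J(3)] R'R[of i 0] R'R[of i 1] by blast+
    show ?thesis
      unfolding Y_def M_def Int_Un_distrib Int_Un_distrib2 1 2 3 4 5 by simp
  qed
  have "\<exists>p. arc p \<and> path_image p \<subseteq> M i \<and> pathstart p = a \<and> pathfinish p = b" if i: "i \<in> ?J" for i
    using Mconn[OF i] aM ab unfolding path_connected_arcwise by blast
  then obtain p where p: "\<And>i. i \<in> ?J \<Longrightarrow> arc (p i) \<and> path_image (p i) \<subseteq> M i \<and> pathstart (p i) = a \<and> pathfinish (p i) = b"
    by metis
  have pM: "path_image (p i) \<subseteq> M i" "a \<in> path_image (p i)" "b \<in> path_image (p i)" if "i \<in> ?J" for i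
    using p[OF that] pathstart_in_path_image[of "p i"] pathfinish_in_path_image[of "p i"] by auto
  have pp: "path_image (p i) \<inter> path_image (p k) = {a, b}" if "i \<in> ?J" "k \<in> ?J" "i \<noteq> k" for i k
    using pM[OF that(1)] pM[OF that(2)] MY[of i] YM[OF that] by blast
  have Yp: "Y i \<inter> path_image (p k) = {}" if "i \<in> ?J" "k \<in> ?J" "i \<noteq> k" for i k
    using pM(1)[OF that(2)] YM[OF that] by blast
  have pY: "path_image (p i) - {a, b} \<subseteq> Y i" if "i \<in> ?J" for i
    using pM(1)[OF that] MY[of i] by blast
  \<comment> \<open>The puncture lies on the circle of disc 0, off the three radii there; the
    regions and the other discs avoid it anyway.\<close>
  obtain u where u: "norm u = 1" "u \<notin> (\<lambda>i. w i 0) ` ?J"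
    using ex_unit_complex_avoiding[of ?J "\<lambda>i. w i 0"] by auto
  let ?q = "H 0 u"
  have qS: "?q \<in> S2" using HS[of 0 UNIV] by blast
  have qB: "?q \<in> B 0" unfolding B_def using u(1) by auto
  have qR: "?q \<notin> R i 0" if i: "i \<in> ?J" for i
  proof
    assume "?q \<in> R i 0"
    then obtain t where t: "0 \<le> t" "H 0 u = H 0 (of_real t * w i 0)" unfolding R_def by auto
    then have eq: "u = of_real t * w i 0" using injD[OF Hinj] by blast
    then have "t = 1" using u(1) t(1) w[OF i J(1)] by (simp add: norm_mult)
    then have "u = w i 0" using eq by simp
    then show False using u(2) i by blast
  qed
  have qY: "Y i \<subseteq> S2 - {?q}" if i: "i \<in> ?J" for i
  proof -
    have "?q \<notin> R i 1" "?q \<notin> R i 2"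
      using RB[OF i J(2)] RB[OF i J(3)] qB disjB[OF J(1,2,4)] disjB[OF J(1,3,5)] by blast+
    moreover have "?q \<notin> W i" using W[OF i] qB J(1) by blast
    ultimately have "?q \<notin> Y i" unfolding Y_def using qR[OF i] R'R[of i 0] R'R[of i 1] by blast
    moreover have "Y i \<subseteq> S2"
    proof -
      have "R i j \<subseteq> S2" "R' i j \<subseteq> S2" for j unfolding R_def R'_def by (rule HS)+
      moreover have "W i \<subseteq> S2" using W[OF i] openin_imp_subset by blast
      ultimately show ?thesis unfolding Y_def by blast
    qed
    ultimately show ?thesis by blast
  qed
  have qab: "{a, b} \<subseteq> S2 - {?q}"
  proof -
    have "a \<in> S2" "b \<in> S2" unfolding a_def b_def using HS[of _ UNIV] by blast+
    moreover have "a \<in> R 0 0" "b \<in> B 1" unfolding a_def b_def B_def Rins by auto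
    ultimately show ?thesis using qR[OF J(1)] qB disjB[OF J(1,2,4)] by blast
  qed
  show False
  proof (rule sphere_theta_no_centre[of "p 0" "p 1" "p 2" a b "Y 0" "Y 1" "Y 2" c ?q])
    show "Y 0 \<inter> (path_image (p 1) \<union> path_image (p 2)) = {}"
      "Y 1 \<inter> (path_image (p 0) \<union> path_image (p 2)) = {}"
      "Y 2 \<inter> (path_image (p 0) \<union> path_image (p 1)) = {}"
      unfolding Int_Un_distrib by (simp_all add: Yp)
  qed (simp_all only: p pp Yconn aM pY qS qab qY J simp_thms not_sym[OF J(4)])
qed

section \<open>Periodicity of the components and the conclusion\<close>

text \<open>The images of \<open>U\<close> are components of \<open>V\<close> of equal positive
  area, and distinct components are disjoint; finite total area forces a repetition, and injectivity
  cancels the common iterate.\<close>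

lemma ex_iterate_fixes_component:
  assumes f: "homeomorphism S2 S2 f g" "area_preserving f"
    and V: "sopen V" "f ` V = V" and U: "U \<in> components V"
  obtains n where "n \<ge> 1" "(f ^^ n) ` U = U"
proof -
  interpret finite_measure sphere_area by (rule finite_measure_sphere_area)
  have fj: "homeomorphism S2 S2 (f ^^ j) (g ^^ j)" for j using homeomorphism_funpow[OF f(1)] .
  have VS: "V \<subseteq> S2" using openin_imp_subset[OF V(1)] .
  have homV: "homeomorphism V V f g"
    by (rule homeomorphism_of_subsets[OF f(1) VS VS V(2)])
  have comp: "(f ^^ j) ` U \<in> components V" for j
    using homeomorphism_component[OF homeomorphism_funpow[OF homV] U] .
  have oU: "sopen U" using sopen_component[OF V(1) U] .
  have ar: "area ((f ^^ j) ` U) = area U" for j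
    using area_image[OF fj area_preserving_funpow[OF f(2)] oU] .
  have pos: "area U > 0" using area_pos[OF oU in_components_nonempty[OF U]] .
  have "\<exists>i j. i < j \<and> (f ^^ i) ` U = (f ^^ j) ` U"
  proof (rule ccontr)
    assume no: "\<not> ?thesis"
    have disj: "disjoint_family_on (\<lambda>j. (f ^^ j) ` U) {..<N}" for N
      unfolding disjoint_family_on_def
    proof (intro ballI impI)
      fix i j :: nat assume "i \<noteq> j"
      then have "(f ^^ i) ` U \<noteq> (f ^^ j) ` U"
        using no by (metis linorder_neqE_nat)
      then show "(f ^^ i) ` U \<inter> (f ^^ j) ` U = {}"
        using components_nonoverlap[OF comp comp] by blast
    qed
    obtain N :: nat where N: "area S2 < real N * area U"
      using pos reals_Archimedean3 by blast
    have s: "(f ^^ j) ` U \<in> sets sphere_area" for j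
      using sopen_sets[OF sopen_component[OF V(1) comp]] .
    have "area (\<Union>j<N. (f ^^ j) ` U) = (\<Sum>j<N. area ((f ^^ j) ` U))"
      by (rule finite_measure_finite_Union) (use s disj in auto)
    also have "\<dots> = real N * area U" by (simp add: ar)
    finally have "area (\<Union>j<N. (f ^^ j) ` U) = real N * area U" .
    moreover have "area (\<Union>j<N. (f ^^ j) ` U) \<le> area S2"
      using bounded_measure[of "\<Union>j<N. (f ^^ j) ` U"] by (simp add: space_sphere_area)
    ultimately show False using N by simp
  qed
  then obtain i j where ij: "i < j" "(f ^^ i) ` U = (f ^^ j) ` U" by blast
  have "(f ^^ i) ` (f ^^ (j - i)) ` U = (f ^^ i) ` U"
    using ij funpow_add[of i "j - i" f] by (simp add: image_comp)
  moreover have "inj_on (f ^^ i) S2"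
    by (rule inj_on_inverseI[of _ "g ^^ i"]) (rule homeomorphism_apply1[OF fj])
  moreover have "(f ^^ (j - i)) ` U \<subseteq> S2" "U \<subseteq> S2"
    using in_components_subset[OF comp] in_components_subset[OF U] VS by blast+
  ultimately have "(f ^^ (j - i)) ` U = U" using inj_on_image_eq_iff by metis
  then show thesis using that[of "j - i"] ij(1) by simp
qed

lemma funpow_image_mult:
  assumes "(f ^^ n) ` U = U"
  shows "(f ^^ (n * m)) ` U = U"
proof (induction m)
  case (Suc m)
  have "(f ^^ (n * Suc m)) ` U = (f ^^ n) ` (f ^^ (n * m)) ` U"
    by (simp add: funpow_add image_comp)
  then show ?case using Suc assms by simp
qed simp

theorem corollary3:
  fixes \<Lambda> U1 U2 U3 :: "(real^3) set" and f :: "real^3 \<Rightarrow> real^3"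
  assumes "\<Lambda> \<subseteq> S2" and "continuum \<Lambda>"
    and "U1 \<in> components (S2 - \<Lambda>)"
    and "U2 \<in> components (S2 - \<Lambda>)"
    and "U3 \<in> components (S2 - \<Lambda>)"
    and "U1 \<noteq> U2" and "U1 \<noteq> U3" and "U2 \<noteq> U3"
    and "top_of_set S2 frontier_of U1 = \<Lambda>"
    and "top_of_set S2 frontier_of U2 = \<Lambda>"
    and "top_of_set S2 frontier_of U3 = \<Lambda>"
    and "\<exists>g. homeomorphism S2 S2 f g"
    and "area_preserving f"
    and "f ` \<Lambda> = \<Lambda>"
  shows "\<exists>n::nat. n \<ge> 1 \<and> (\<forall>x\<in>\<Lambda>. (f ^^ n) x = x)"
proof -
  obtain g where f: "homeomorphism S2 S2 f g" using assms(12) by blast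
  have \<Lambda>: "compact \<Lambda>" "connected \<Lambda>" using assms(2) by (simp_all add: continuum_def)
  let ?V = "S2 - \<Lambda>"
  have oV: "sopen ?V" by (rule sopen_compact_diff[OF \<Lambda>(1)]) simp
  have injf: "inj_on f S2" by (rule inj_on_inverseI) (rule homeomorphism_apply1[OF f])
  have fV: "f ` ?V = ?V"
    using inj_on_image_set_diff[OF injf, of S2 \<Lambda>] assms(1,14) homeomorphism_image1[OF f] by simp
  obtain n1 where n1: "n1 \<ge> 1" "(f ^^ n1) ` U1 = U1"
    using ex_iterate_fixes_component[OF f assms(13) oV fV assms(3)] .
  obtain n2 where n2: "n2 \<ge> 1" "(f ^^ n2) ` U2 = U2"
    using ex_iterate_fixes_component[OF f assms(13) oV fV assms(4)] .
  obtain n3 where n3: "n3 \<ge> 1" "(f ^^ n3) ` U3 = U3"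
    using ex_iterate_fixes_component[OF f assms(13) oV fV assms(5)] .
  define p where "p = n1 * n2 * n3"
  have p1: "p \<ge> 1" using n1(1) n2(1) n3(1) by (simp add: p_def)
  have pU: "(f ^^ p) ` U1 = U1" "(f ^^ p) ` U2 = U2" "(f ^^ p) ` U3 = U3"
    using funpow_image_mult[OF n1(2), of "n2 * n3"] funpow_image_mult[OF n2(2), of "n1 * n3"]
      funpow_image_mult[OF n3(2), of "n1 * n2"] by (simp_all add: p_def ac_simps)
  define U where "U i = (if i = 0 then U1 else if i = 1 then U2 else U3)" for i :: nat
  have Ucomp: "U i \<in> components ?V" and Uinv: "(f ^^ p) ` U i = U i"
    and Ufr: "top_of_set S2 frontier_of U i = \<Lambda>" for i
    using assms(3-5,9-11) pU by (simp_all add: U_def)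
  have F: "homeomorphism S2 S2 (f ^^ p) (g ^^ p)" using homeomorphism_funpow[OF f] .
  have conS: "connected S2" by (rule connected_sphere) simp
  have period: "(f ^^ p) x = x \<or> ((f ^^ p) ^^ 2) x = x" if x: "x \<in> \<Lambda>" for x
  proof (rule ccontr)
    assume no: "\<not> ?thesis"
    show False
    proof (rule no_disjoint_triple_images[OF F area_preserving_funpow[OF assms(13)], of U x])
      fix i :: nat
      \<comment> \<open>The common boundary places \<open>x\<close> in the closure of each domain,
        while connectedness of \<Lambda> makes the complement of each domain connected.\<close>
      have "x \<in> top_of_set S2 closure_of U i"
        using x Ufr[of i] unfolding frontier_of_def by blast
      then have "x \<in> closure (U i)"
        using closure_of_subtopology_subset[of euclidean S2 "U i"] by (simp add: subset_iff)
      then show "sopen (U i) \<and> connected (U i) \<and> connected (S2 - U i) \<and> (f ^^ p) ` U i = U i \<and> x \<in> closure (U i)"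
        using sopen_component[OF oV Ucomp] in_components_connected[OF Ucomp] Uinv
          component_diff_connected[OF \<Lambda>(2) conS assms(1) Ucomp] by blast
    next
      fix i k :: nat assume "i \<in> {0, 1, 2}" "k \<in> {0, 1, 2}" "i \<noteq> k"
      then have "U i \<noteq> U k" using assms(6-8) by (auto simp: U_def)
      then show "U i \<inter> U k = {}" using components_nonoverlap[OF Ucomp Ucomp] by blast
    qed (use no x assms(1) in auto)
  qed
  show ?thesis
  \<comment> \<open>A fixed point of the iterate is also fixed by its square, so the doubled
    exponent covers both alternatives of \<open>period\<close>.\<close>
  proof (intro exI[of _ "p * 2"] conjI ballI)
    show "p * 2 \<ge> 1" using p1 by simp
    fix x assume "x \<in> \<Lambda>"
    then have "((f ^^ p) ^^ 2) x = x" using period[of x] by (auto simp: numeral_2_eq_2)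
    then show "(f ^^ (p * 2)) x = x" by (simp add: funpow_mult mult.commute)
  qed
qed

end
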